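(* Assume there is an oracle $\mathcal{O}$ which, given any nonsingular $B'\in\mathbb{Z}^{n\times n}$, returns $\lambda_1(L(B'))$ (optimization SVP). Then there is an algorithm which, given any nonsingular $B\in\mathbb{Z}^{n\times n}$, outputs a vector $v\in L(B)$ with $\|v\|=\lambda_1(L(B))$ (search SVP), making exactly one call to $\mathcal{O}$ (on a nonsingular integer $n\times n$ matrix), and running in time polynomial in $\log_2 M$, $n$ and $\log_2 n$, where $M=\max_{i,j}|b_{ij}|$ is the largest absolute value of an entry of $B$.
   Context: For a nonsingular $B\in\mathbb{R}^{n\times n}$ with columns $b_1,\dots,b_n$, the lattice is $L(B)=\{\sum_{i=1}^n x_ib_i : x_i\in\mathbb{Z}\}$ and $\lambda_1(L(B))$ is the Euclidean length of a shortest nonzero vector of $L(B)$. Oracle calls are counted as unit cost. *)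

theory Defs
  imports "Jordan_Normal_Form.Determinant" "HOL-Library.Log_Nat"
begin

definition lattice :: "int mat \<Rightarrow> int vec set" where
  "lattice B = {B *\<^sub>v x | x. x \<in> carrier_vec (dim_col B)}"

definition vnorm :: "int vec \<Rightarrow> real" where
  "vnorm v = sqrt (real_of_int (v \<bullet> v))"

definition lambda1 :: "int mat \<Rightarrow> real" where
  "lambda1 B = Inf {vnorm v | v. v \<in> lattice B \<and> v \<noteq> 0\<^sub>v (dim_row B)}"

definition max_entry :: "int mat \<Rightarrow> int" where
  "max_entry B = Max {\<bar>B $$ (i,j)\<bar> | i j. i < dim_row B \<and> j < dim_col B}"

type_synonym mem = "nat \<Rightarrow> int"

definition sz :: "int \<Rightarrow> nat" where
  "sz x = floorlog 2 (nat \<bar>x\<bar>)"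

datatype aexp = Const int | Load aexp | Add aexp aexp | Sub aexp aexp
  | Mul aexp aexp | Dv aexp aexp | Md aexp aexp

datatype bexp = Less aexp aexp | Eq aexp aexp | NotB bexp | AndB bexp bexp

datatype com = SKIP | Store aexp aexp | Seq com com | IfC bexp com com
  | WhileC bexp com | OracleC aexp

fun aval :: "aexp \<Rightarrow> mem \<Rightarrow> int \<times> nat" where
  "aval (Const c) s = (c, 1 + sz c)"
| "aval (Load a) s = (let (x, c) = aval a s in (s (nat x), c + 1 + sz x + sz (s (nat x))))"
| "aval (Add a b) s = (let (x, c) = aval a s; (y, d) = aval b s in (x + y, c + d + 1 + sz x + sz y))"
| "aval (Sub a b) s = (let (x, c) = aval a s; (y, d) = aval b s in (x - y, c + d + 1 + sz x + sz y))"
| "aval (Mul a b) s = (let (x, c) = aval a s; (y, d) = aval b s in (x * y, c + d + (1 + sz x) * (1 + sz y)))"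
| "aval (Dv a b) s = (let (x, c) = aval a s; (y, d) = aval b s in (x div y, c + d + (1 + sz x) * (1 + sz y)))"
| "aval (Md a b) s = (let (x, c) = aval a s; (y, d) = aval b s in (x mod y, c + d + (1 + sz x) * (1 + sz y)))"

fun bval :: "bexp \<Rightarrow> mem \<Rightarrow> bool \<times> nat" where
  "bval (Less a b) s = (let (x, c) = aval a s; (y, d) = aval b s in (x < y, c + d + 1 + sz x + sz y))"
| "bval (Eq a b) s = (let (x, c) = aval a s; (y, d) = aval b s in (x = y, c + d + 1 + sz x + sz y))"
| "bval (NotB b) s = (let (x, c) = bval b s in (\<not> x, c + 1))"
| "bval (AndB a b) s = (let (x, c) = bval a s; (y, d) = bval b s in (x \<and> y, c + d + 1))"

definition query_mat :: "mem \<Rightarrow> nat \<Rightarrow> int mat" where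
  "query_mat s p = (let k = nat (s p) in mat k k (\<lambda>(i, j). s (p + 1 + i * k + j)))"

text \<open>Big-step semantics: big c s s' t qs means that command c run from
  memory s halts in memory s' with total cost t, and qs is the list of the
  dimensions of the oracle queries made (in order). The oracle may only be
  called on a nonsingular square integer matrix of dimension at least 1; it
  answers (exactly) lambda1 squared, which is an integer, written to register p.
  An oracle call has unit cost (plus the cost of evaluating its address).\<close>

inductive big :: "com \<Rightarrow> mem \<Rightarrow> mem \<Rightarrow> nat \<Rightarrow> nat list \<Rightarrow> bool" where
  Skip: "big SKIP s s 1 []"
| Store: "aval a s = (x, c) \<Longrightarrow> aval e s = (y, d) \<Longrightarrow>
    big (Store a e) s (s(nat x := y)) (c + d + 1) []"
| Seq: "big c1 s s1 t1 q1 \<Longrightarrow> big c2 s1 s2 t2 q2 \<Longrightarrow>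
    big (Seq c1 c2) s s2 (t1 + t2) (q1 @ q2)"
| IfT: "bval b s = (True, cb) \<Longrightarrow> big c1 s s' t q \<Longrightarrow> big (IfC b c1 c2) s s' (cb + t + 1) q"
| IfF: "bval b s = (False, cb) \<Longrightarrow> big c2 s s' t q \<Longrightarrow> big (IfC b c1 c2) s s' (cb + t + 1) q"
| WhileF: "bval b s = (False, cb) \<Longrightarrow> big (WhileC b c) s s (cb + 1) []"
| WhileT: "bval b s = (True, cb) \<Longrightarrow> big c s s1 t1 q1 \<Longrightarrow> big (WhileC b c) s1 s2 t2 q2 \<Longrightarrow>
    big (WhileC b c) s s2 (cb + t1 + t2 + 1) (q1 @ q2)"
| Oracle: "aval a s = (x, c) \<Longrightarrow> p = nat x \<Longrightarrow> s p \<ge> 1 \<Longrightarrow>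
    det (query_mat s p) \<noteq> 0 \<Longrightarrow>
    big (OracleC a) s (s(p := \<lfloor>(lambda1 (query_mat s p))\<^sup>2\<rfloor>)) (c + 1) [nat (s p)]"

definition input_mem :: "nat \<Rightarrow> int mat \<Rightarrow> mem" where
  "input_mem n B = (\<lambda>a. if a = 0 then int n
     else if a - 1 < n * n then B $$ ((a - 1) div n, (a - 1) mod n) else 0)"

definition output_vec :: "nat \<Rightarrow> mem \<Rightarrow> int vec" where
  "output_vec n s = vec n (\<lambda>i. s (i + 1))"

end

(* The queried matrix is B' = K B + e_0 p^T with p_j = N^j and K much larger than N^(2n).
   With y = B x and L = p . x one gets |B' x|^2 = K^2 |y|^2 + 2 K y_0 L + L^2. Cofactor bounds
   give |y_0 L| <= E |y|^2 with 2E < K, so the first term dominates: B' is nonsingular and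
   every minimiser x for B' is a minimiser for B. For such an x also L^2 < K, hence
   lambda1(B')^2 mod K = L^2. Its square root determines x up to sign, because the coordinates
   of x are the balanced base-N digits of L. *)

theory Submission
  imports Defs
begin

subsection \<open>Determinant bounds\<close>

text \<open>The oracle yields a single number, so one query has to carry a whole coefficient vector
  without disturbing which vectors are shortest. Integrality makes room for this: squared lengths in
  L(B) differ by at least 1 when they differ at all, and scaling widens that gap to K^2. Competing
  vectors can be arbitrarily long, so the cross term must be controlled in proportion to |y|^2; an
  absolute bound would not do. The constants have to be computable by the program itself and have
  polynomially many bits. The product of 1 + b^2 over all entries serves every purpose at once: it
  is computed in one pass over the input, it dominates the determinant, all cofactors and the
  squared length of each column, and its bit length is polynomial in n and log M. Since the cost
  model charges for bit lengths, the program proof also keeps every memory cell within a common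
  bound \<open>H = K ^ 4\<close>. Each elementary step then has a uniform cost, and the running time
  reduces to counting steps.\<close>

definition entry_prod :: "int mat \<Rightarrow> int" where
  "entry_prod A = (\<Prod>i<dim_row A. \<Prod>j<dim_col A. 1 + (A $$ (i,j))\<^sup>2)"

lemma one_le_entry_prod: "1 \<le> entry_prod A"
  unfolding entry_prod_def by (intro prod_ge_1) auto

lemma sum_le_prod_one_plus:
  fixes f :: "'a \<Rightarrow> int"
  assumes "finite I" "\<And>i. i \<in> I \<Longrightarrow> 0 \<le> f i"
  shows "1 + sum f I \<le> (\<Prod>i\<in>I. 1 + f i)"
  using assms
proof (induction I rule: finite_induct)
  case (insert a I)
  have s: "0 \<le> sum f I" using insert.prems by (intro sum_nonneg) auto
  have a: "0 \<le> f a" using insert.prems by simp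
  have "1 + sum f (insert a I) \<le> (1 + f a) * (1 + sum f I)"
    using insert.hyps s a by (simp add: algebra_simps)
  also have "\<dots> \<le> (1 + f a) * (\<Prod>i\<in>I. 1 + f i)"
    using insert.IH insert.prems a by (intro mult_left_mono) auto
  finally show ?case using insert.hyps by simp
qed simp

lemma prod_insert_index_le:
  fixes f :: "nat \<Rightarrow> int"
  assumes "j < Suc m" "\<And>k. 1 \<le> f k"
  shows "(\<Prod>k<m. f (insert_index j k)) \<le> (\<Prod>k<Suc m. f k)"
proof -
  have "(\<Prod>k<m. f (insert_index j k)) = prod f (insert_index j ` {..<m})"
    by (subst prod.reindex) (auto intro: insert_index_inj_on)
  also have "\<dots> \<le> prod f {..<Suc m}"
    using assms(1) assms(2)[THEN order_trans[OF zero_le_one]] assms(2)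
    by (intro prod_mono2) (auto simp: insert_index_def)
  finally show ?thesis .
qed

lemma mat_delete_entry:
  assumes "A \<in> carrier_mat (Suc m) (Suc m)" "i < m" "j < m"
  shows "mat_delete A r c $$ (i,j) = A $$ (insert_index r i, insert_index c j)"
  using assms by (auto simp: mat_delete_def insert_index_def)

text \<open>Deleting row \<open>r\<close> removes the whole factor of that row, while deleting
  column \<open>c\<close> only drops factors that are at least 1 from the other rows. The row factor
  kept on the left is what lets the Laplace induction close.\<close>

lemma entry_prod_mat_delete:
  assumes A: "A \<in> carrier_mat (Suc m) (Suc m)" and r: "r < Suc m" and c: "c < Suc m"
  shows "(\<Prod>j<Suc m. 1 + (A $$ (r,j))\<^sup>2) * entry_prod (mat_delete A r c) \<le> entry_prod A"
proof -
  let ?R = "\<lambda>i. \<Prod>j<Suc m. 1 + (A $$ (i,j))\<^sup>2"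
  have R: "1 \<le> ?R i" for i by (intro prod_ge_1) auto
  have "entry_prod (mat_delete A r c) = (\<Prod>i<m. \<Prod>j<m. 1 + (A $$ (insert_index r i, insert_index c j))\<^sup>2)"
    using A by (auto simp: entry_prod_def mat_delete_entry intro!: prod.cong)
  also have "\<dots> \<le> (\<Prod>i<m. ?R (insert_index r i))"
    by (intro prod_mono conjI prod_nonneg prod_insert_index_le[OF c]) auto
  also have "\<dots> = prod ?R (insert_index r ` {..<m})"
    by (subst prod.reindex) (auto intro: insert_index_inj_on)
  also have "insert_index r ` {..<m} = {..<Suc m} - {r}"
  proof -
    have "x \<in> insert_index r ` {..<m}" if "x < Suc m" "x \<noteq> r" for x
      using that r by (intro image_eqI[of _ _ "delete_index r x"]) (auto simp: insert_delete_index delete_index_def)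
    thus ?thesis by (auto simp: insert_index_def split: if_splits)
  qed
  finally have "?R r * entry_prod (mat_delete A r c) \<le> ?R r * prod ?R ({..<Suc m} - {r})"
    using R[of r] by (intro mult_left_mono) auto
  also have "\<dots> = prod ?R {..<Suc m}"
    using r by (subst prod.remove[of "{..<Suc m}" r]) auto
  finally show ?thesis using A by (simp add: entry_prod_def)
qed

lemma abs_le_square: "\<bar>a\<bar> \<le> a\<^sup>2" for a :: int
proof (cases "a = 0")
  case False
  hence "\<bar>a\<bar> * 1 \<le> \<bar>a\<bar> * \<bar>a\<bar>" by (intro mult_left_mono) auto
  thus ?thesis by (simp add: power2_eq_square)
qed simp

lemma abs_det_le_entry_prod:
  assumes "A \<in> carrier_mat m m"
  shows "\<bar>det A\<bar> \<le> entry_prod A"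
  using assms
proof (induction m arbitrary: A)
  case 0
  thus ?case using one_le_entry_prod[of A] by simp
next
  case (Suc m)
  let ?r = "\<Prod>j<Suc m. 1 + (A $$ (0,j))\<^sup>2"
  have r1: "1 \<le> ?r" by (intro prod_ge_1) auto
  have le: "?r * \<bar>cofactor A 0 j\<bar> \<le> entry_prod A" if "j < Suc m" for j
  proof -
    have "\<bar>cofactor A 0 j\<bar> \<le> entry_prod (mat_delete A 0 j)"
      using Suc.IH[OF mat_delete_carrier[of A "Suc m" "Suc m" 0 j, simplified]] Suc.prems
      by (simp add: cofactor_def abs_mult power_abs)
    hence "?r * \<bar>cofactor A 0 j\<bar> \<le> ?r * entry_prod (mat_delete A 0 j)"
      using r1 by (intro mult_left_mono) auto
    thus ?thesis using entry_prod_mat_delete[OF Suc.prems, of 0 j] that by simp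
  qed
  have "\<bar>det A\<bar> \<le> (\<Sum>j<Suc m. \<bar>A $$ (0,j) * cofactor A 0 j\<bar>)"
    unfolding laplace_expansion_row[OF Suc.prems zero_less_Suc] by (rule sum_abs)
  \<comment> \<open>Weighting by the row factor \<open>?r\<close> replaces a division: each
    \<open>?r\<close> times a cofactor is at most \<open>entry_prod A\<close>, and since an integer
    is bounded by its square, the remaining sum of row entries is at most \<open>?r\<close>, which
    cancels at the end.\<close>
  hence "?r * \<bar>det A\<bar> \<le> ?r * (\<Sum>j<Suc m. \<bar>A $$ (0,j) * cofactor A 0 j\<bar>)"
    using r1 by (intro mult_left_mono) auto
  also have "\<dots> = (\<Sum>j<Suc m. \<bar>A $$ (0,j)\<bar> * (?r * \<bar>cofactor A 0 j\<bar>))"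
    by (simp only: sum_distrib_left abs_mult mult.left_commute)
  also have "\<dots> \<le> (\<Sum>j<Suc m. (A $$ (0,j))\<^sup>2 * entry_prod A)"
    using one_le_entry_prod[of A] r1
    by (intro sum_mono mult_mono le abs_le_square) auto
  also have "\<dots> = (\<Sum>j<Suc m. (A $$ (0,j))\<^sup>2) * entry_prod A"
    by (rule sum_distrib_right[symmetric])
  also have "\<dots> \<le> ?r * entry_prod A"
    using sum_le_prod_one_plus[of "{..<Suc m}" "\<lambda>j. (A $$ (0,j))\<^sup>2"] one_le_entry_prod[of A]
    by (intro mult_right_mono) auto
  finally show ?case using r1 by (simp only: mult_le_cancel_left)
qed

lemma abs_cofactor_le_entry_prod:
  assumes "A \<in> carrier_mat m m" "i < m" "j < m"
  shows "\<bar>cofactor A i j\<bar> \<le> entry_prod A"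
proof -
  obtain k where m: "m = Suc k" using assms(2) by (cases m) auto
  have "\<bar>cofactor A i j\<bar> \<le> entry_prod (mat_delete A i j)"
    using abs_det_le_entry_prod[OF mat_delete_carrier[of A "Suc k" "Suc k" i j, simplified]] assms m
    by (simp add: cofactor_def abs_mult power_abs)
  also have "\<dots> \<le> (\<Prod>j<Suc k. 1 + (A $$ (i,j))\<^sup>2) * entry_prod (mat_delete A i j)"
    using one_le_entry_prod[of "mat_delete A i j"]
      prod_ge_1[of "{..<Suc k}" "\<lambda>j. 1 + (A $$ (i,j))\<^sup>2"]
    by (simp only: mult_le_cancel_right1) auto
  also have "\<dots> \<le> entry_prod A"
    using assms m by (intro entry_prod_mat_delete) auto
  finally show ?thesis .
qed

lemma sum_powers_le:
  fixes r :: int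
  assumes "2 \<le> r"
  shows "(\<Sum>j<m. r ^ j) \<le> r ^ m"
proof (induction m)
  case (Suc m)
  have "(\<Sum>j<Suc m. r ^ j) \<le> 2 * r ^ m" using Suc by simp
  also have "\<dots> \<le> r ^ Suc m" using assms by (simp add: mult_right_mono)
  finally show ?case .
qed simp

section \<open>Attained minima and their stability under perturbation\<close>

lemma ex_minimal_lattice_vector:
  assumes A: "A \<in> carrier_mat n n" and d: "det A \<noteq> 0" and n: "1 \<le> n"
  obtains x where "x \<in> carrier_vec n" "x \<noteq> 0\<^sub>v n"
    "\<And>z. z \<in> carrier_vec n \<Longrightarrow> z \<noteq> 0\<^sub>v n \<Longrightarrow> (A *\<^sub>v x) \<bullet> (A *\<^sub>v x) \<le> (A *\<^sub>v z) \<bullet> (A *\<^sub>v z)"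
    "lambda1 A = vnorm (A *\<^sub>v x)"
proof -
  let ?P = "\<lambda>x. x \<in> carrier_vec n \<and> x \<noteq> 0\<^sub>v n"
  let ?q = "\<lambda>x. (A *\<^sub>v x) \<bullet> (A *\<^sub>v x)"
  have q0: "0 \<le> ?q x" for x by (simp add: scalar_prod_def sum_nonneg)
  have "?P (unit_vec n 0)" using n by auto
  \<comment> \<open>Squared lengths are nonnegative integers, so well-ordering supplies a minimiser
    and no compactness argument is involved.\<close>
  from ex_has_least_nat[of ?P, OF this, of "\<lambda>x. nat (?q x)"]
  obtain x where x: "?P x" and "\<forall>z. ?P z \<longrightarrow> nat (?q x) \<le> nat (?q z)" by blast
  hence min: "?P z \<Longrightarrow> ?q x \<le> ?q z" for z using q0 by (simp add: nat_le_eq_zle)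
  have nz: "?P z \<Longrightarrow> A *\<^sub>v z \<noteq> 0\<^sub>v n" for z
    using d det_0_iff_vec_prod_zero[OF A] by blast
  have "lambda1 A = vnorm (A *\<^sub>v x)"
    unfolding lambda1_def
  proof (rule cInf_eq_minimum)
    show "vnorm (A *\<^sub>v x) \<in> {vnorm v |v. v \<in> lattice A \<and> v \<noteq> 0\<^sub>v (dim_row A)}"
      using x nz[OF x] A by (auto simp: lattice_def)
  next
    fix r assume "r \<in> {vnorm v |v. v \<in> lattice A \<and> v \<noteq> 0\<^sub>v (dim_row A)}"
    then obtain z where z: "z \<in> carrier_vec n" "A *\<^sub>v z \<noteq> 0\<^sub>v n" "r = vnorm (A *\<^sub>v z)"
      using A by (auto simp: lattice_def)
    have "z \<noteq> 0\<^sub>v n" using z(2) A by auto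
    thus "vnorm (A *\<^sub>v x) \<le> r" using min[of z] z by (simp add: vnorm_def)
  qed
  thus ?thesis using that[of x] x min by blast
qed

text \<open>Here \<open>q\<close> and \<open>q'\<close> are values of the main form,
  \<open>c\<close> and \<open>c'\<close> the cross terms, \<open>l\<close> and \<open>l'\<close> the
  squared functionals. Only \<open>q\<close> is bounded by \<open>W\<close>. The cross term
  belonging to \<open>q'\<close> is absorbed proportionally, leaving
  \<open>K * ((K - 2 * E) * q')\<close>, which is monotone in \<open>q'\<close>; this reduces the
  claim to \<open>q' = q + 1\<close>.\<close>

lemma perturbed_form_less:
  fixes K E W q q' c c' l l' :: int
  assumes "0 \<le> E" "0 \<le> l'" "l < K" "q \<le> W" "q + 1 \<le> q'" "\<bar>c\<bar> \<le> E * q" "\<bar>c'\<bar> \<le> E * q'"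
    "0 \<le> q" "2 * E * (2 * W + 1) + 1 \<le> K"
  shows "K\<^sup>2 * q + 2 * K * c + l < K\<^sup>2 * q' + 2 * K * c' + l'"
proof -
  have "2 * E * (2 * q + 1) \<le> 2 * E * (2 * W + 1)" using assms by (intro mult_left_mono) auto
  hence K: "2 * E * (2 * q + 1) + 1 \<le> K" using assms(9) by linarith
  have "0 \<le> 2 * E * (2 * q + 1)" using assms by simp
  hence K0: "0 < K" using K by linarith
  have "0 \<le> E * q" using assms by simp
  hence KE: "0 \<le> K - 2 * E" using K assms by (simp add: algebra_simps)
  have "K\<^sup>2 * q + 2 * K * c + l < K\<^sup>2 * q + 2 * K * (E * q) + K"
    using assms K0 by (intro add_le_less_mono add_left_mono mult_left_mono) auto
  \<comment> \<open>The subtracted product is \<open>K\<close> times the slack in the lower bound on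
    \<open>K\<close>, hence nonnegative.\<close>
  also have "\<dots> = K * ((K - 2 * E) * (q + 1)) - K * (K - (2 * E * (2 * q + 1) + 1))"
    by (simp add: algebra_simps power2_eq_square)
  also have "\<dots> \<le> K * ((K - 2 * E) * (q + 1))" using K K0 by simp
  also have "\<dots> \<le> K * ((K - 2 * E) * q')"
    using K0 KE assms by (intro mult_left_mono) auto
  also have "\<dots> = K\<^sup>2 * q' + 2 * K * (- (E * q'))" by (simp add: algebra_simps power2_eq_square)
  also have "\<dots> \<le> K\<^sup>2 * q' + 2 * K * c' + l'"
  proof -
    have "2 * K * (- (E * q')) \<le> 2 * K * c'" using assms K0 by (intro mult_left_mono) auto
    thus ?thesis using assms by linarith
  qed
  finally show ?thesis .
qed

subsection \<open>The perturbed lattice\<close>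

locale svp_instance =
  fixes n :: nat and B :: "int mat"
  assumes n_ge_1: "1 \<le> n" and B: "B \<in> carrier_mat n n" and det_B: "det B \<noteq> 0"
begin

text \<open>The factor \<open>n\<close> pays for the \<open>n\<close> cofactor terms in the adjugate
  formula for one coordinate. It also puts the dimension below \<open>W\<close>, so that loop
  counters stay small.\<close>

definition W :: int where "W = int n * entry_prod B"
text \<open>Coordinates of short vectors lie between \<open>- W\<^sup>2\<close> and
  \<open>W\<^sup>2\<close>, an interval with exactly \<open>N\<close> integers: a balanced residue
  system modulo \<open>N\<close>.\<close>

definition N :: int where "N = 2 * W\<^sup>2 + 1"
text \<open>For a short vector \<open>L x\<close> is at most \<open>N ^ n * N\<close> in absolute
  value; the third factor \<open>N\<close> makes \<open>K\<close> strictly larger than its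
  square.\<close>

definition K :: int where "K = N ^ n * N ^ n * N ^ 3"
definition B' :: "int mat" where
  "B' = mat n n (\<lambda>(i, j). K * B $$ (i, j) + (if i = 0 then N ^ j else 0))"

definition y :: "int vec \<Rightarrow> nat \<Rightarrow> int" where "y x i = (\<Sum>j<n. B $$ (i, j) * x $ j)"
definition Q :: "int vec \<Rightarrow> int" where "Q x = (\<Sum>i<n. (y x i)\<^sup>2)"
definition L :: "int vec \<Rightarrow> int" where "L x = (\<Sum>j<n. N ^ j * x $ j)"

section \<open>Comparing the sizes of the constants\<close>

lemma n_le_W: "int n \<le> W"
  using one_le_entry_prod[of B] mult_left_mono[of 1 "entry_prod B" "int n"] by (simp add: W_def)

lemma entry_prod_le_W: "entry_prod B \<le> W"
  using one_le_entry_prod[of B] mult_right_mono[of 1 "int n" "entry_prod B"] n_ge_1 by (simp add: W_def)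

lemma W_ge_1: "1 \<le> W" using n_le_W n_ge_1 by linarith

text \<open>The sum is below the product of the factors of column \<open>j\<close>, and the other
  columns contribute factors of at least 1. Evaluated at a unit vector, this bounds the squared
  minimum of L(B) by \<open>W\<close>.\<close>

lemma col_sq_le_W:
  assumes "j < n"
  shows "(\<Sum>i<n. (B $$ (i, j))\<^sup>2) \<le> W"
proof -
  have "(\<Sum>i<n. (B $$ (i, j))\<^sup>2) \<le> (\<Prod>i<n. 1 + (B $$ (i, j))\<^sup>2)"
    using sum_le_prod_one_plus[of "{..<n}" "\<lambda>i. (B $$ (i, j))\<^sup>2"] by simp
  also have "\<dots> \<le> (\<Prod>i<n. \<Prod>j<n. 1 + (B $$ (i, j))\<^sup>2)"
  proof (rule prod_mono, safe)
    fix i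
    have "(\<Prod>j\<in>{j}. 1 + (B $$ (i, j))\<^sup>2) \<le> (\<Prod>j<n. 1 + (B $$ (i, j))\<^sup>2)"
      using assms by (intro prod_mono2) auto
    thus "1 + (B $$ (i, j))\<^sup>2 \<le> (\<Prod>j<n. 1 + (B $$ (i, j))\<^sup>2)" by simp
  qed auto
  also have "\<dots> = entry_prod B" using B by (simp add: entry_prod_def)
  finally show ?thesis using entry_prod_le_W by linarith
qed

lemma abs_entry_le_W:
  assumes "i < n" "j < n"
  shows "\<bar>B $$ (i, j)\<bar> \<le> W"
  using col_sq_le_W[OF assms(2)] abs_le_square[of "B $$ (i, j)"] assms(1)
    member_le_sum[of i "{..<n}" "\<lambda>i. (B $$ (i, j))\<^sup>2"] by simp

lemma N_ge_3: "3 \<le> N"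
  using one_le_power[OF W_ge_1, of 2] by (simp add: N_def)

lemma sum_N_le: "(\<Sum>j<n. N ^ j) \<le> N ^ n"
  using N_ge_3 by (intro sum_powers_le) simp

lemma W_sq_less_N: "2 * W\<^sup>2 < N" by (simp add: N_def)

lemma W_less_N: "2 * W < N"
proof -
  have "W * 1 \<le> W * W" using W_ge_1 by (intro mult_left_mono) auto
  thus ?thesis by (simp add: N_def power2_eq_square)
qed

lemma K_gt_pow: "N ^ n * N ^ n * N\<^sup>2 < K"
proof -
  have "N ^ n * N ^ n * N\<^sup>2 * 1 < N ^ n * N ^ n * N\<^sup>2 * N"
    using N_ge_3 by (intro mult_strict_left_mono) auto
  thus ?thesis by (simp add: K_def power3_eq_cube power2_eq_square mult.assoc)
qed

text \<open>This is the lower bound on \<open>K\<close> demanded by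
  \<open>perturbed_form_less\<close>, with \<open>E = N ^ n * W\<close>, the constant of
  \<open>cross_term_le\<close>.\<close>

lemma K_ge: "2 * (N ^ n * W) * (2 * W + 1) + 1 \<le> K"
proof -
  have p: "1 \<le> N ^ n" using N_ge_3 by simp
  have "2 * W * (2 * W + 1) = 2 * (2 * W\<^sup>2) + 2 * W" by (simp add: power2_eq_square algebra_simps)
  also have "\<dots> \<le> 3 * N" using W_sq_less_N W_less_N by linarith
  also have "\<dots> \<le> N * N" using N_ge_3 by (intro mult_right_mono) auto
  finally have "N ^ n * (2 * W * (2 * W + 1)) \<le> N ^ n * (N * N)"
    using p by (intro mult_left_mono) auto
  also have "\<dots> \<le> N ^ n * (N * N) * N ^ n"
    using p N_ge_3 mult_left_mono[of 1 "N ^ n" "N ^ n * (N * N)"] by simp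
  also have "\<dots> < K" using K_gt_pow by (simp add: power2_eq_square ac_simps)
  finally show ?thesis by (simp add: algebra_simps)
qed

section \<open>The quadratic forms of the original and the perturbed matrix\<close>

lemma B_mult_nth: "x \<in> carrier_vec n \<Longrightarrow> i < n \<Longrightarrow> (B *\<^sub>v x) $ i = y x i"
  using B by (auto simp: y_def scalar_prod_def lessThan_atLeast0 intro!: sum.cong)

lemma B_sq: "x \<in> carrier_vec n \<Longrightarrow> (B *\<^sub>v x) \<bullet> (B *\<^sub>v x) = Q x"
  using B by (auto simp: scalar_prod_def Q_def B_mult_nth lessThan_atLeast0 power2_eq_square
      simp del: index_mult_mat_vec intro!: sum.cong)

lemma B'_mult_nth:
  assumes x: "x \<in> carrier_vec n" and i: "i < n"
  shows "(B' *\<^sub>v x) $ i = K * y x i + (if i = 0 then L x else 0)"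
proof -
  have "(B' *\<^sub>v x) $ i = (\<Sum>j<n. (K * B $$ (i, j) + (if i = 0 then N ^ j else 0)) * x $ j)"
    using assms by (auto simp: B'_def scalar_prod_def lessThan_atLeast0 intro!: sum.cong)
  thus ?thesis
    by (simp add: y_def L_def ring_distribs sum.distrib sum_distrib_left mult.assoc)
qed

lemma B'_sq:
  assumes x: "x \<in> carrier_vec n"
  shows "(B' *\<^sub>v x) \<bullet> (B' *\<^sub>v x) = K\<^sup>2 * Q x + 2 * K * (y x 0 * L x) + (L x)\<^sup>2"
proof -
  have "(B' *\<^sub>v x) \<bullet> (B' *\<^sub>v x) = (\<Sum>i<n. ((B' *\<^sub>v x) $ i)\<^sup>2)"
    by (auto simp: scalar_prod_def lessThan_atLeast0 power2_eq_square B'_def intro!: sum.cong)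
  also have "\<dots> = (\<Sum>i<n. K\<^sup>2 * (y x i)\<^sup>2 + (if i = 0 then 2 * K * (y x 0 * L x) + (L x)\<^sup>2 else 0))"
    using x by (intro sum.cong) (auto simp: B'_mult_nth power2_eq_square algebra_simps)
  also have "\<dots> = K\<^sup>2 * Q x + (2 * K * (y x 0 * L x) + (L x)\<^sup>2)"
    using n_ge_1 by (simp add: sum.distrib Q_def sum_distrib_left)
  finally show ?thesis by simp
qed

lemma Q_nonneg: "0 \<le> Q x" by (simp add: Q_def sum_nonneg)

lemma y_sq_le_Q: "i < n \<Longrightarrow> (y x i)\<^sup>2 \<le> Q x"
  unfolding Q_def by (rule member_le_sum) auto

lemma abs_y_mult_le_Q:
  assumes "i < n" "j < n"
  shows "\<bar>y x i\<bar> * \<bar>y x j\<bar> \<le> Q x"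
proof (cases "\<bar>y x i\<bar> \<le> \<bar>y x j\<bar>")
  case True
  hence "\<bar>y x i\<bar> * \<bar>y x j\<bar> \<le> \<bar>y x j\<bar> * \<bar>y x j\<bar>" by (intro mult_right_mono) auto
  thus ?thesis using y_sq_le_Q[OF assms(2), of x] by (simp add: power2_eq_square)
next
  case False
  hence "\<bar>y x i\<bar> * \<bar>y x j\<bar> \<le> \<bar>y x i\<bar> * \<bar>y x i\<bar>" by (intro mult_left_mono) auto
  thus ?thesis using y_sq_le_Q[OF assms(1), of x] by (simp add: power2_eq_square)
qed

section \<open>Cramer bounds on coefficient vectors\<close>

lemma abs_coord_le_sum:
  assumes x: "x \<in> carrier_vec n" and k: "k < n"
  shows "\<bar>x $ k\<bar> \<le> (\<Sum>j<n. entry_prod B * \<bar>y x j\<bar>)"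
proof -
  \<comment> \<open>Cramer's rule in adjugate form, which expresses the coordinate through
    \<open>y\<close> without leaving the integers.\<close>
  have "det B * x $ k = ((det B \<cdot>\<^sub>m 1\<^sub>m n) *\<^sub>v x) $ k" using x k by simp
  also have "\<dots> = ((adj_mat B * B) *\<^sub>v x) $ k" by (simp only: adj_mat(3)[OF B])
  also have "\<dots> = (adj_mat B *\<^sub>v (B *\<^sub>v x)) $ k"
    using adj_mat(1)[OF B] B x by (simp add: assoc_mult_mat_vec)
  also have "\<dots> = (\<Sum>j<n. cofactor B j k * y x j)"
    using B x k adj_mat(1)[OF B] B_mult_nth[OF x]
    by (auto simp: adj_mat_def scalar_prod_def lessThan_atLeast0 intro!: sum.cong)
  finally have eq: "det B * x $ k = (\<Sum>j<n. cofactor B j k * y x j)" .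
  \<comment> \<open>A nonzero integer determinant has absolute value at least 1, so multiplying by
    it cannot shrink the coordinate.\<close>
  have "\<bar>x $ k\<bar> \<le> \<bar>det B * x $ k\<bar>"
    using det_B mult_right_mono[of 1 "\<bar>det B\<bar>" "\<bar>x $ k\<bar>"] by (simp add: abs_mult)
  also have "\<dots> \<le> (\<Sum>j<n. \<bar>cofactor B j k\<bar> * \<bar>y x j\<bar>)"
    unfolding eq by (rule order_trans[OF sum_abs]) (simp add: abs_mult)
  also have "\<dots> \<le> (\<Sum>j<n. entry_prod B * \<bar>y x j\<bar>)"
    using B k by (intro sum_mono mult_right_mono abs_cofactor_le_entry_prod) auto
  finally show ?thesis .
qed

lemma abs_coord_le:
  assumes x: "x \<in> carrier_vec n" and k: "k < n"
  shows "\<bar>x $ k\<bar> \<le> W * Q x"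
proof -
  have "(\<Sum>j<n. entry_prod B * \<bar>y x j\<bar>) \<le> (\<Sum>j<n. entry_prod B * Q x)"
    using y_sq_le_Q[of _ x] one_le_entry_prod[of B]
    by (intro sum_mono mult_left_mono order_trans[OF abs_le_square]) auto
  thus ?thesis using abs_coord_le_sum[OF assms] by (simp add: W_def)
qed

text \<open>Bounding the two factors separately by multiples of \<open>Q x\<close> would give
  \<open>(Q x)\<^sup>2\<close>, useless for long vectors. The coordinate is linear in
  \<open>y\<close>, so the product is a sum of terms \<open>y x j * y x i\<close>, each at most
  \<open>Q x\<close>.\<close>

lemma coord_mult_y_le:
  assumes x: "x \<in> carrier_vec n" and k: "k < n" and i: "i < n"
  shows "\<bar>x $ k\<bar> * \<bar>y x i\<bar> \<le> W * Q x"
proof -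
  have "\<bar>x $ k\<bar> * \<bar>y x i\<bar> \<le> (\<Sum>j<n. entry_prod B * \<bar>y x j\<bar>) * \<bar>y x i\<bar>"
    using abs_coord_le_sum[OF x k] by (intro mult_right_mono) auto
  also have "\<dots> = (\<Sum>j<n. entry_prod B * (\<bar>y x j\<bar> * \<bar>y x i\<bar>))"
    by (simp add: sum_distrib_right mult.assoc)
  also have "\<dots> \<le> (\<Sum>j<n. entry_prod B * Q x)"
    using one_le_entry_prod[of B] i by (intro sum_mono mult_left_mono abs_y_mult_le_Q) auto
  finally show ?thesis by (simp add: W_def)
qed

lemma weighted_sum_le:
  assumes "\<And>j. j < n \<Longrightarrow> \<bar>a j\<bar> \<le> c" "0 \<le> c"
  shows "\<bar>\<Sum>j<n. N ^ j * a j\<bar> \<le> N ^ n * c"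
proof -
  have "\<bar>\<Sum>j<n. N ^ j * a j\<bar> \<le> (\<Sum>j<n. N ^ j * c)"
    using N_ge_3 assms
    by (intro order_trans[OF sum_abs] sum_mono) (auto simp: abs_mult intro: mult_left_mono)
  also have "\<dots> = (\<Sum>j<n. N ^ j) * c" by (rule sum_distrib_right[symmetric])
  also have "\<dots> \<le> N ^ n * c" using sum_N_le assms(2) by (rule mult_right_mono)
  finally show ?thesis .
qed

lemma cross_term_le:
  assumes x: "x \<in> carrier_vec n"
  shows "\<bar>y x 0 * L x\<bar> \<le> N ^ n * W * Q x"
proof -
  have "y x 0 * L x = (\<Sum>j<n. N ^ j * (x $ j * y x 0))"
    by (simp add: L_def sum_distrib_left ac_simps)
  thus ?thesis
    using weighted_sum_le[of "\<lambda>j. x $ j * y x 0" "W * Q x"] coord_mult_y_le[OF x] n_ge_1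
      W_ge_1 Q_nonneg[of x] by (simp add: abs_mult mult.assoc)
qed

lemma Q_pos:
  assumes x: "x \<in> carrier_vec n" "x \<noteq> 0\<^sub>v n"
  shows "1 \<le> Q x"
proof (rule ccontr)
  assume "\<not> 1 \<le> Q x"
  hence "Q x = 0" using Q_nonneg[of x] by linarith
  hence "x $ k = 0" if "k < n" for k using abs_coord_le[OF x(1) that] by simp
  thus False using x by (auto simp: vec_eq_iff)
qed

lemma L_le:
  assumes x: "x \<in> carrier_vec n" and Q: "Q x \<le> W"
  shows "\<bar>L x\<bar> \<le> N ^ n * W\<^sup>2"
proof -
  have "W * Q x \<le> W\<^sup>2" using Q W_ge_1 by (simp add: power2_eq_square)
  hence "\<bar>x $ k\<bar> \<le> W\<^sup>2" if "k < n" for k using abs_coord_le[OF x that] by linarith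
  thus ?thesis unfolding L_def by (intro weighted_sum_le) auto
qed

lemma L_sq_less_K:
  assumes x: "x \<in> carrier_vec n" and Q: "Q x \<le> W"
  shows "(L x)\<^sup>2 < K"
proof -
  have "\<bar>L x\<bar> \<le> N ^ n * N"
  proof -
    have "N ^ n * W\<^sup>2 \<le> N ^ n * N"
      using W_sq_less_N N_ge_3 by (intro mult_left_mono) auto
    thus ?thesis using L_le[OF assms] by linarith
  qed
  hence "\<bar>L x\<bar>\<^sup>2 \<le> (N ^ n * N)\<^sup>2" by (intro power_mono) auto
  thus ?thesis using K_gt_pow by (simp add: power2_eq_square ac_simps)
qed

section \<open>Minimisers of the perturbed form\<close>

lemma det_B': "det B' \<noteq> 0"
proof
  assume "det B' = 0"
  moreover have "B' \<in> carrier_mat n n" by (simp add: B'_def)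
  ultimately obtain x where x: "x \<in> carrier_vec n" "x \<noteq> 0\<^sub>v n" and "B' *\<^sub>v x = 0\<^sub>v n"
    using det_0_iff_vec_prod_zero by blast
  hence "K\<^sup>2 * Q x + 2 * K * (y x 0 * L x) + (L x)\<^sup>2 = 0"
    using B'_sq[OF x(1)] by simp
  \<comment> \<open>Comparison with the zero vector: \<open>q = c = l = 0\<close> in
    \<open>perturbed_form_less\<close> gives positivity on nonzero vectors.
    \<open>L_sq_less_K\<close> at the zero vector supplies \<open>0 < K\<close>.\<close>
  moreover have "K\<^sup>2 * 0 + 2 * K * 0 + 0 < K\<^sup>2 * Q x + 2 * K * (y x 0 * L x) + (L x)\<^sup>2"
    using cross_term_le[OF x(1)] Q_pos[OF x] K_ge N_ge_3 W_ge_1 L_sq_less_K[of "0\<^sub>v n"]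
    by (intro perturbed_form_less[where E = "N ^ n * W" and W = W]) (auto simp: Q_def y_def L_def)
  ultimately show False by simp
qed

text \<open>Everything the program proof needs from lattice theory. The bound \<open>K ^ 4\<close>
  lets the answer fit into memory, the range of \<open>L x\<close> brackets the bisection for its
  root, and the coordinate bound makes the digits unique.\<close>

lemma decodable_minimiser:
  obtains x where "x \<in> carrier_vec n" "lambda1 B = vnorm (B *\<^sub>v x)"
    "\<lfloor>(lambda1 B')\<^sup>2\<rfloor> mod K = (L x)\<^sup>2" "\<bar>\<lfloor>(lambda1 B')\<^sup>2\<rfloor>\<bar> \<le> K ^ 4" "0 \<le> L x" "L x < K"
    "\<And>k. k < n \<Longrightarrow> \<bar>x $ k\<bar> \<le> W\<^sup>2"
proof -
  obtain x0 where x0: "x0 \<in> carrier_vec n" "x0 \<noteq> 0\<^sub>v n"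
    "\<And>z. z \<in> carrier_vec n \<Longrightarrow> z \<noteq> 0\<^sub>v n \<Longrightarrow> (B *\<^sub>v x0) \<bullet> (B *\<^sub>v x0) \<le> (B *\<^sub>v z) \<bullet> (B *\<^sub>v z)"
    "lambda1 B = vnorm (B *\<^sub>v x0)"
    using ex_minimal_lattice_vector[OF B det_B n_ge_1] by blast
  have min0: "Q x0 \<le> Q z" if "z \<in> carrier_vec n" "z \<noteq> 0\<^sub>v n" for z
    using x0(3)[OF that] x0(1) that by (simp add: B_sq)
  have "Q x0 \<le> Q (unit_vec n 0)" using n_ge_1 by (intro min0) auto
  also have "\<dots> = (\<Sum>i<n. (B $$ (i, 0))\<^sup>2)"
  proof -
    have "y (unit_vec n 0) i = B $$ (i, 0)" for i
    proof -
      have "y (unit_vec n 0) i = (\<Sum>j<n. if j = 0 then B $$ (i, j) else 0)"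
        unfolding y_def by (intro sum.cong) auto
      thus ?thesis using n_ge_1 by simp
    qed
    thus ?thesis by (simp add: Q_def)
  qed
  also have "\<dots> \<le> W" using n_ge_1 by (intro col_sq_le_W) auto
  finally have q0: "Q x0 \<le> W" .
  have cB': "B' \<in> carrier_mat n n" by (simp add: B'_def)
  obtain z where z: "z \<in> carrier_vec n" "z \<noteq> 0\<^sub>v n"
    "\<And>u. u \<in> carrier_vec n \<Longrightarrow> u \<noteq> 0\<^sub>v n \<Longrightarrow> (B' *\<^sub>v z) \<bullet> (B' *\<^sub>v z) \<le> (B' *\<^sub>v u) \<bullet> (B' *\<^sub>v u)"
    "lambda1 B' = vnorm (B' *\<^sub>v z)"
    using ex_minimal_lattice_vector[OF cB' det_B' n_ge_1] by blast
  \<comment> \<open>Both \<open>z\<close> and \<open>- z\<close> are minimisers and only the square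
    of \<open>L\<close> is visible, so the sign is chosen to make the root nonnegative.\<close>
  define x where "x = (if 0 \<le> L z then z else - z)"
  have x: "x \<in> carrier_vec n" using z by (simp add: x_def)
  have nth: "i < n \<Longrightarrow> (- z) $ i = - z $ i" for i using z by simp
  have L: "L x = \<bar>L z\<bar>"
    using nth by (simp add: x_def L_def sum_negf)
  have Qx: "Q x = Q z" and yL: "y x 0 * L x = y z 0 * L z"
    using nth by (auto simp: x_def Q_def y_def L_def sum_negf)
  \<comment> \<open>Were \<open>z\<close> longer than \<open>x0\<close> under \<open>B\<close>, the
    integral gap would make \<open>x0\<close> strictly better than \<open>z\<close> under
    \<open>B'\<close>.\<close>
  have Qz: "Q z = Q x0"
  proof (rule ccontr)
    assume "Q z \<noteq> Q x0"
    hence "Q x0 + 1 \<le> Q z" using min0[OF z(1,2)] by linarith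
    hence "K\<^sup>2 * Q x0 + 2 * K * (y x0 0 * L x0) + (L x0)\<^sup>2 < K\<^sup>2 * Q z + 2 * K * (y z 0 * L z) + (L z)\<^sup>2"
      using cross_term_le[OF z(1)] cross_term_le[OF x0(1)] K_ge N_ge_3 W_ge_1 L_sq_less_K[OF x0(1) q0]
        q0 Q_nonneg
      by (intro perturbed_form_less[where E = "N ^ n * W" and W = W]) auto
    thus False using z(3)[OF x0(1,2)] B'_sq z(1) x0(1) by simp
  qed
  have Q: "Q x \<le> W" using q0 Qz Qx by simp
  let ?f = "K\<^sup>2 * Q x + 2 * K * (y x 0 * L x) + (L x)\<^sup>2"
  have "(B' *\<^sub>v z) \<bullet> (B' *\<^sub>v z) = ?f" unfolding B'_sq[OF z(1)] Qx yL by (simp add: L)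
  moreover have "0 \<le> (B' *\<^sub>v z) \<bullet> (B' *\<^sub>v z)" by (simp add: scalar_prod_def sum_nonneg)
  moreover from this have "\<lfloor>(lambda1 B')\<^sup>2\<rfloor> = (B' *\<^sub>v z) \<bullet> (B' *\<^sub>v z)"
    by (simp add: z(4) vnorm_def)
  ultimately have fl: "\<lfloor>(lambda1 B')\<^sup>2\<rfloor> = ?f" and f0: "0 \<le> ?f"
    by simp_all
  have Lsq: "(L x)\<^sup>2 < K" by (rule L_sq_less_K[OF x Q])
  have "?f mod K = (L x)\<^sup>2 mod K"
  proof -
    have "?f = (L x)\<^sup>2 + K * (K * Q x + 2 * (y x 0 * L x))" by (simp add: algebra_simps power2_eq_square)
    thus ?thesis by (simp only: mod_mult_self2)
  qed
  also have "\<dots> = (L x)\<^sup>2" using Lsq by (intro mod_pos_pos_trivial) auto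
  finally have md: "?f mod K = (L x)\<^sup>2" .
  have "\<bar>L x\<bar> < K" using Lsq abs_le_square[of "L x"] by linarith
  have K9: "9 \<le> K"
  proof -
    have "3 * 3 \<le> N * N" using N_ge_3 by (intro mult_mono) auto
    also have "\<dots> \<le> N ^ n * N ^ n * (N * N)"
      using N_ge_3 mult_mono[of 1 "N ^ n" 1 "N ^ n"] mult_right_mono[of 1 "N ^ n * N ^ n" "N * N"] by simp
    finally show ?thesis using K_gt_pow by (simp add: power2_eq_square)
  qed
  have EK: "N ^ n * W * (2 * W + 1) \<le> K" 
  proof -
    have "0 \<le> N ^ n * W * (2 * W + 1)" using N_ge_3 W_ge_1 by simp
    moreover have "2 * (N ^ n * W * (2 * W + 1)) + 1 \<le> K" using K_ge by (simp only: mult.assoc)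
    ultimately show ?thesis by linarith
  qed
  have "N ^ n * W * Q x \<le> N ^ n * W * (2 * W + 1)"
    using Q W_ge_1 N_ge_3 by (intro mult_left_mono) auto
  hence c: "\<bar>y x 0 * L x\<bar> \<le> K" using cross_term_le[OF x] EK by linarith
  have "1 * W \<le> N ^ n * (W * (2 * W + 1))"
    using W_ge_1 N_ge_3 mult_left_mono[of 1 "2 * W + 1" W] by (intro mult_mono) auto
  hence "Q x \<le> K" using EK Q by (simp add: mult.assoc)
  hence "?f \<le> K\<^sup>2 * K + 2 * K * K + K"
    using c Lsq K9 by (intro add_mono mult_left_mono) auto
  also have "\<dots> \<le> K\<^sup>2 * K + K\<^sup>2 * K + K\<^sup>2 * K"
  proof -
    have "2 * K * K \<le> K * K * K" using K9 by (intro mult_right_mono) auto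
    moreover have "1 * K \<le> (K * K) * K" using K9 mult_mono[of 1 K 1 K] by (intro mult_right_mono) auto
    ultimately show ?thesis by (simp add: power2_eq_square)
  qed
  also have "\<dots> = 3 * K ^ 3" by (simp add: power2_eq_square power3_eq_cube)
  also have "\<dots> \<le> K * K ^ 3" using K9 by (intro mult_right_mono) auto
  also have "\<dots> = K ^ 4" by (simp add: eval_nat_numeral)
  finally have f4: "\<bar>?f\<bar> \<le> K ^ 4" using f0 by simp
  have "lambda1 B = vnorm (B *\<^sub>v x)"
    using x0(1,4) x Qx Qz by (simp add: vnorm_def B_sq)
  moreover have "\<bar>x $ k\<bar> \<le> W\<^sup>2" if "k < n" for k
  proof -
    have "W * Q x \<le> W * W" using Q W_ge_1 by (intro mult_left_mono) auto
    thus ?thesis using abs_coord_le[OF x that] by (simp add: power2_eq_square)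
  qed
  ultimately show ?thesis
    using x md f4 fl \<open>\<bar>L x\<bar> < K\<close> L by (intro that[of x]) auto
qed

end

subsection \<open>Symbolic execution with cost bounds\<close>

lemma sz_le_iff: "sz x \<le> k \<longleftrightarrow> \<bar>x\<bar> < 2 ^ k"
proof -
  have "sz x \<le> k \<longleftrightarrow> nat \<bar>x\<bar> < 2 ^ k" by (simp add: sz_def floorlog_le_iff)
  also have "\<dots> \<longleftrightarrow> \<bar>x\<bar> < 2 ^ k" by (simp add: nat_less_iff)
  finally show ?thesis .
qed

lemma abs_less_sz: "\<bar>x\<bar> < 2 ^ sz x"
  using sz_le_iff by blast

lemma sz_mono: "\<bar>x\<bar> \<le> \<bar>y\<bar> \<Longrightarrow> sz x \<le> sz y"
  using abs_less_sz[of y] by (simp add: sz_le_iff)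

lemma sz_le_nat_abs: "sz x \<le> nat \<bar>x\<bar>"
proof -
  have "int (nat \<bar>x\<bar>) < 2 ^ nat \<bar>x\<bar>" using of_nat_less_two_power by blast
  thus ?thesis by (simp add: sz_le_iff)
qed

lemma sz_add: "sz (x + y) \<le> sz x + sz y + 1"
proof -
  have "\<bar>x + y\<bar> \<le> \<bar>x\<bar> + \<bar>y\<bar>" by simp
  also have "\<dots> < 2 ^ sz x + 2 ^ sz y" using abs_less_sz by (intro add_strict_mono)
  also have "\<dots> \<le> 2 ^ (sz x + sz y) + 2 ^ (sz x + sz y)"
    by (intro add_mono power_increasing) auto
  finally show ?thesis by (simp add: sz_le_iff)
qed

lemma sz_uminus [simp]: "sz (- x) = sz x" by (simp add: sz_def)

lemma sz_diff: "sz (x - y) \<le> sz x + sz y + 1"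
  using sz_add[of x "- y"] by simp

lemma sz_mult: "sz (x * y) \<le> sz x + sz y"
proof -
  have "\<bar>x\<bar> * \<bar>y\<bar> < 2 ^ sz x * 2 ^ sz y"
    using abs_less_sz by (intro mult_strict_mono') auto
  thus ?thesis by (simp add: sz_le_iff abs_mult power_add)
qed

lemma abs_div_le_int: "\<bar>x div y\<bar> \<le> \<bar>x\<bar>" for x y :: int
proof -
  have pos: "\<bar>x div y\<bar> \<le> \<bar>x\<bar>" if "0 < y" for x y :: int
  proof (cases "0 \<le> x")
    case True
    thus ?thesis using that zdiv_mono2[of x 1 y] by (simp add: pos_imp_zdiv_nonneg_iff)
  next
    case False
    hence "x div 1 \<le> x div y" using that by (intro zdiv_mono2_neg) auto
    moreover have "x div y < 0" using False that by (simp add: pos_imp_zdiv_neg_iff)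
    ultimately show ?thesis by simp
  qed
  consider "y = 0" | "0 < y" | "y < 0" by linarith
  thus ?thesis
  proof cases
    case 3
    thus ?thesis using pos[of "- y" "- x"] by simp
  qed (use pos in auto)
qed

lemma sz_div: "sz (x div y) \<le> sz x"
  by (rule sz_mono[OF abs_div_le_int])

lemma sz_mod: "sz (x mod y) \<le> sz x + sz y"
proof (cases "y = 0")
  case False
  hence "\<bar>x mod y\<bar> \<le> \<bar>y\<bar>" by (metis abs_mod_less less_imp_le)
  from sz_mono[OF this] show ?thesis by simp
qed simp

lemma sz_1 [simp]: "sz 1 = 1" and sz_2 [simp]: "sz 2 = 2"
  by (auto simp: sz_def floorlog_def)

lemma sz_power: "sz (x ^ k) \<le> k * sz x + 1"
proof (induction k)
  case (Suc k)
  thus ?case using sz_mult[of x "x ^ k"] by simp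
qed simp

lemma sz_prod_le:
  assumes "\<And>i. i \<in> A \<Longrightarrow> sz (f i) \<le> c"
  shows "sz (prod f A) \<le> card A * c + 1"
  using assms
proof (induction A rule: infinite_finite_induct)
  case (insert a A)
  have "sz (prod f A) \<le> card A * c + 1" using insert by simp
  thus ?case using sz_mult[of "f a" "prod f A"] insert.hyps insert.prems[of a] by simp
qed auto

lemma sz_le_log:
  assumes "1 \<le> z"
  shows "real (sz z) \<le> log 2 (real_of_int z) + 1"
proof -
  have "2 ^ (sz z - 1) \<le> nat \<bar>z\<bar>"
    unfolding sz_def using assms floorlog_bounds[of "nat \<bar>z\<bar>" 2] by simp
  hence "real (2 ^ (sz z - 1)) \<le> real (nat \<bar>z\<bar>)" by (rule of_nat_mono)
  hence "2 ^ (sz z - 1) \<le> real_of_int z" using assms by simp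
  hence "real (sz z - 1) \<le> log 2 (real_of_int z)"
    using assms by (subst le_log_iff) (auto simp: powr_realpow)
  thus ?thesis by linarith
qed

text \<open>Constants count with their absolute value, a crude bound for their bit length,
  so that the simplifier can evaluate \<open>asz\<close>.\<close>

fun asz :: "aexp \<Rightarrow> nat" where
  "asz (Const c) = 1 + nat \<bar>c\<bar>"
| "asz (Load a) = asz a + 1"
| "asz (Add a b) = asz a + asz b + 1"
| "asz (Sub a b) = asz a + asz b + 1"
| "asz (Mul a b) = asz a + asz b + 1"
| "asz (Dv a b) = asz a + asz b + 1"
| "asz (Md a b) = asz a + asz b + 1"

fun bsz :: "bexp \<Rightarrow> nat" where
  "bsz (Less a b) = asz a + asz b + 1"
| "bsz (Eq a b) = asz a + asz b + 1"
| "bsz (NotB b) = bsz b + 1"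
| "bsz (AndB a b) = bsz a + bsz b + 1"

definition av :: "aexp \<Rightarrow> mem \<Rightarrow> int" where "av a s = fst (aval a s)"
definition bv :: "bexp \<Rightarrow> mem \<Rightarrow> bool" where "bv b s = fst (bval b s)"

lemma av_simps [simp]:
  "av (Const c) s = c"
  "av (Load a) s = s (nat (av a s))"
  "av (Add a b) s = av a s + av b s"
  "av (Sub a b) s = av a s - av b s"
  "av (Mul a b) s = av a s * av b s"
  "av (Dv a b) s = av a s div av b s"
  "av (Md a b) s = av a s mod av b s"
  by (simp_all add: av_def split: prod.splits)

lemma bv_simps [simp]:
  "bv (Less a b) s = (av a s < av b s)"
  "bv (Eq a b) s = (av a s = av b s)"
  "bv (NotB p) s = (\<not> bv p s)"
  "bv (AndB p q) s = (bv p s \<and> bv q s)"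
  by (simp_all add: av_def bv_def split: prod.splits)

section \<open>Cost of evaluating expressions\<close>

definition bounded :: "int \<Rightarrow> mem \<Rightarrow> bool" where
  "bounded H s \<longleftrightarrow> (\<forall>a. \<bar>s a\<bar> \<le> H)"

lemma bounded_upd: "bounded H s \<Longrightarrow> \<bar>x\<bar> \<le> H \<Longrightarrow> bounded H (s(a := x))"
  by (simp add: bounded_def)

text \<open>The cost bound \<open>a ^ 3 * s\<^sup>2\<close> is closed under binary operators:
  operands of at most \<open>a * s\<close> and \<open>b * s\<close> bits add at most
  \<open>(1 + a) * (1 + b) * s\<^sup>2\<close>, which the growth from \<open>a ^ 3 + b ^ 3\<close>
  to \<open>(a + b + 1) ^ 3\<close> absorbs.\<close>

lemma cube_ineq:
  fixes a b s x y c d :: nat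
  assumes "c \<le> a ^ 3 * s\<^sup>2" "d \<le> b ^ 3 * s\<^sup>2" "x \<le> a * s" "y \<le> b * s" "1 \<le> s"
  shows "c + d + (1 + x) * (1 + y) \<le> (a + b + 1) ^ 3 * s\<^sup>2"
proof -
  have "(1 + x) * (1 + y) \<le> (s + a * s) * (s + b * s)" using assms by (intro mult_mono) auto
  also have "\<dots> = (1 + a) * (1 + b) * s\<^sup>2" by (simp add: power2_eq_square algebra_simps)
  finally have "c + d + (1 + x) * (1 + y) \<le> (a ^ 3 + b ^ 3 + (1 + a) * (1 + b)) * s\<^sup>2"
    using assms by (simp add: algebra_simps)
  also have "\<dots> \<le> (a + b + 1) ^ 3 * s\<^sup>2"
    by (intro mult_right_mono) (auto simp: algebra_simps power3_eq_cube)
  finally show ?thesis .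
qed

lemma cube_ineq_add:
  fixes a b s x y c d :: nat
  assumes "c \<le> a ^ 3 * s\<^sup>2" "d \<le> b ^ 3 * s\<^sup>2" "x \<le> a * s" "y \<le> b * s" "1 \<le> s"
  shows "c + d + 1 + x + y \<le> (a + b + 1) ^ 3 * s\<^sup>2"
  using cube_ineq[OF assms] by simp

text \<open>Value size and cost go through one induction, because the charge for an operator depends
  on the bit lengths of its operands.\<close>

lemma aval_bounds:
  assumes s: "bounded H s"
  shows "sz (fst (aval a s)) \<le> asz a * (sz H + 1) \<and> snd (aval a s) \<le> asz a ^ 3 * (sz H + 1)\<^sup>2"
proof (induction a)
  case (Const c)
  have "sz c + 1 \<le> 1 + nat \<bar>c\<bar>" using sz_le_nat_abs[of c] by simp
  moreover have "m \<le> m * (sz H + 1)" "m \<le> m ^ 3 * (sz H + 1)\<^sup>2" for m :: nat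
  proof -
    show "m \<le> m * (sz H + 1)" by simp
    have "m * (1 * 1) \<le> m * ((m * m) * (sz H + 1)\<^sup>2)"
      by (cases "m = 0") (auto intro!: mult_le_mono)
    thus "m \<le> m ^ 3 * (sz H + 1)\<^sup>2" by (simp add: power3_eq_cube mult.assoc)
  qed
  ultimately show ?case by (auto intro: order_trans)
next
  case (Load a)
  obtain x c where ac: "aval a s = (x, c)" by force
  have S: "sz (s (nat x)) \<le> sz H"
    using s by (intro sz_mono) (auto simp: bounded_def intro: order_trans[OF _ abs_ge_self])
  have "c + 0 + 1 + sz x + sz (s (nat x)) \<le> (asz a + 1) ^ 3 * (sz H + 1)\<^sup>2"
  proof -
    have "sz x \<le> asz a * (sz H + 1)" "c \<le> asz a ^ 3 * (sz H + 1)\<^sup>2" using Load ac by auto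
    moreover have "1 + asz a * (sz H + 1) + sz H \<le> (asz a + 1) * (sz H + 1)\<^sup>2"
      by (simp add: power2_eq_square algebra_simps)
    moreover have "asz a ^ 3 + (asz a + 1) \<le> (asz a + 1) ^ 3"
      by (simp add: power3_eq_cube algebra_simps)
    hence "(asz a ^ 3 + (asz a + 1)) * (sz H + 1)\<^sup>2 \<le> (asz a + 1) ^ 3 * (sz H + 1)\<^sup>2"
      by (rule mult_right_mono) simp
    ultimately show ?thesis using S unfolding distrib_right by linarith
  qed
  thus ?case using S ac by (simp add: trans_le_add2)
next
  case (Add a b)
  obtain x c y d where "aval a s = (x, c)" "aval b s = (y, d)" by force
  thus ?case using Add sz_add[of x y] cube_ineq_add[of c "asz a" "sz H + 1" d "asz b" "sz x" "sz y"]
    by (simp add: algebra_simps)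
next
  case (Sub a b)
  obtain x c y d where "aval a s = (x, c)" "aval b s = (y, d)" by force
  thus ?case using Sub sz_diff[of x y] cube_ineq_add[of c "asz a" "sz H + 1" d "asz b" "sz x" "sz y"]
    by (simp add: algebra_simps)
next
  case (Mul a b)
  obtain x c y d where "aval a s = (x, c)" "aval b s = (y, d)" by force
  thus ?case using Mul sz_mult[of x y] cube_ineq[of c "asz a" "sz H + 1" d "asz b" "sz x" "sz y"]
    by (simp add: algebra_simps)
next
  case (Dv a b)
  obtain x c y d where "aval a s = (x, c)" "aval b s = (y, d)" by force
  thus ?case using Dv sz_div[of x y] cube_ineq[of c "asz a" "sz H + 1" d "asz b" "sz x" "sz y"]
    by (simp add: algebra_simps)
next
  case (Md a b)
  obtain x c y d where "aval a s = (x, c)" "aval b s = (y, d)" by force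
  thus ?case using Md sz_mod[of x y] cube_ineq[of c "asz a" "sz H + 1" d "asz b" "sz x" "sz y"]
    by (simp add: algebra_simps)
qed

lemma bval_bounds:
  assumes s: "bounded H s"
  shows "snd (bval b s) \<le> bsz b ^ 3 * (sz H + 1)\<^sup>2"
proof -
  have ge: "x ^ 3 * (sz H + 1)\<^sup>2 + y ^ 3 * (sz H + 1)\<^sup>2 + 1 \<le> (x + y + 1) ^ 3 * (sz H + 1)\<^sup>2" for x y
    using cube_ineq_add[of "x ^ 3 * (sz H + 1)\<^sup>2" x "sz H + 1" "y ^ 3 * (sz H + 1)\<^sup>2" y 0 0] by simp
  show ?thesis
  proof (induction b)
    case (Less a b)
    obtain x c y d where "aval a s = (x, c)" "aval b s = (y, d)" by force
    thus ?case using aval_bounds[OF s, of a] aval_bounds[OF s, of b]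
        cube_ineq_add[of c "asz a" "sz H + 1" d "asz b" "sz x" "sz y"] by simp
  next
    case (Eq a b)
    obtain x c y d where "aval a s = (x, c)" "aval b s = (y, d)" by force
    thus ?case using aval_bounds[OF s, of a] aval_bounds[OF s, of b]
        cube_ineq_add[of c "asz a" "sz H + 1" d "asz b" "sz x" "sz y"] by simp
  next
    case (NotB b)
    obtain x c where "bval b s = (x, c)" by force
    thus ?case using NotB ge[of "bsz b" 0] by simp
  next
    case (AndB a b)
    obtain x c y d where "bval a s = (x, c)" "bval b s = (y, d)" by force
    thus ?case using AndB ge[of "bsz a" "bsz b"] by simp
  qed
qed

text \<open>Bounds the cost of one store or one test whose expressions have size at most 200,
  when all memory cells are bounded by \<open>H\<close>; the step counts \<open>m\<close> below are multiples of it.\<close>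

definition unit_cost :: "int \<Rightarrow> nat" where
  "unit_cost H = 20000000 * (sz H + 1)\<^sup>2"

text \<open>Total correctness in which \<open>m\<close> is an upper bound on steps but
  \<open>q\<close> is the exact query trace. Having \<open>bounded H\<close> both before and after
  the run makes the memory bound an implicit invariant of every rule.\<close>

definition wp :: "int \<Rightarrow> com \<Rightarrow> nat \<Rightarrow> nat list \<Rightarrow> (mem \<Rightarrow> bool) \<Rightarrow> mem \<Rightarrow> bool" where
  "wp H c m q R s \<longleftrightarrow> (bounded H s \<longrightarrow>
     (\<exists>s' t. big c s s' t q \<and> t \<le> m * unit_cost H \<and> bounded H s' \<and> R s'))"

section \<open>Proof rules for total correctness with step counts\<close>

lemma aval_cost:
  assumes "bounded H s" "asz a \<le> 200"
  shows "snd (aval a s) \<le> 8000000 * (sz H + 1)\<^sup>2"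
proof -
  \<comment> \<open>\<open>8000000\<close> is the cube of 200; two such costs plus 1 still fit into
    \<open>unit_cost\<close>.\<close>
  have "asz a ^ 3 \<le> 200 ^ 3" using assms by (intro power_mono) auto
  hence "asz a ^ 3 * (sz H + 1)\<^sup>2 \<le> 8000000 * (sz H + 1)\<^sup>2" by (intro mult_right_mono) auto
  thus ?thesis using aval_bounds[OF assms(1), of a] by linarith
qed

lemma bval_cost:
  assumes "bounded H s" "bsz b \<le> 200"
  shows "snd (bval b s) + 2 \<le> unit_cost H"
proof -
  have "bsz b ^ 3 \<le> 200 ^ 3" using assms by (intro power_mono) auto
  hence "bsz b ^ 3 * (sz H + 1)\<^sup>2 \<le> 8000000 * (sz H + 1)\<^sup>2" by (intro mult_right_mono) auto
  thus ?thesis using bval_bounds[OF assms(1), of b] by (simp add: unit_cost_def power2_eq_square)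
qed

lemma wp_Store:
  assumes "asz a \<le> 200" "asz e \<le> 200"
    "\<bar>av e s\<bar> \<le> H" "0 < m" "R (s(nat (av a s) := av e s))"
  shows "wp H (Store a e) m [] R s"
  unfolding wp_def
proof
  assume b: "bounded H s"
  have "big (Store a e) s (s(nat (av a s) := av e s)) (snd (aval a s) + snd (aval e s) + 1) []"
    unfolding av_def by (rule big.Store[OF prod.collapse[symmetric] prod.collapse[symmetric]])
  moreover have "snd (aval a s) + snd (aval e s) + 1 \<le> 1 * unit_cost H"
    using aval_cost[OF b assms(1)] aval_cost[OF b assms(2)] by (simp add: unit_cost_def power2_eq_square)
  moreover have "1 * unit_cost H \<le> m * unit_cost H" using assms(4) by (intro mult_right_mono) auto
  ultimately show "\<exists>s' t. big (Store a e) s s' t [] \<and> t \<le> m * unit_cost H \<and> bounded H s' \<and> R s'"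
    using bounded_upd[OF b assms(3)] assms(5) le_trans by blast
qed

lemma wp_Seq:
  assumes "wp H c1 m1 q1 (wp H c2 m2 q2 R) s"
  shows "wp H (Seq c1 c2) (m1 + m2) (q1 @ q2) R s"
  unfolding wp_def
proof
  assume "bounded H s"
  then obtain s1 t1 where 1: "big c1 s s1 t1 q1" "t1 \<le> m1 * unit_cost H" "bounded H s1" "wp H c2 m2 q2 R s1"
    using assms unfolding wp_def by blast
  then obtain s2 t2 where 2: "big c2 s1 s2 t2 q2" "t2 \<le> m2 * unit_cost H" "bounded H s2" "R s2"
    unfolding wp_def by blast
  have "t1 + t2 \<le> (m1 + m2) * unit_cost H" using 1 2 by (simp add: distrib_right)
  thus "\<exists>s' t. big (Seq c1 c2) s s' t (q1 @ q2) \<and> t \<le> (m1 + m2) * unit_cost H \<and> bounded H s' \<and> R s'"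
    using big.Seq[OF 1(1) 2(1)] 2 by blast
qed

lemma wp_If:
  assumes "bsz b \<le> 200" "bv b s \<Longrightarrow> wp H c1 m q R s" "\<not> bv b s \<Longrightarrow> wp H c2 m q R s"
  shows "wp H (IfC b c1 c2) (m + 1) q R s"
  unfolding wp_def
proof
  assume bd: "bounded H s"
  obtain v cb where v: "bval b s = (v, cb)" by force
  have cb: "cb + 2 \<le> unit_cost H" using bval_cost[OF bd assms(1)] v by simp
  have "wp H (if v then c1 else c2) m q R s" using assms(2,3) v by (auto simp: bv_def)
  then obtain s' t where 1: "big (if v then c1 else c2) s s' t q" "t \<le> m * unit_cost H" "bounded H s'" "R s'"
    using bd unfolding wp_def by blast
  have "big (IfC b c1 c2) s s' (cb + t + 1) q"
    using 1(1) v big.IfT big.IfF by (cases v) auto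
  moreover have "cb + t + 1 \<le> (m + 1) * unit_cost H" using 1 cb by simp
  ultimately show "\<exists>s' t. big (IfC b c1 c2) s s' t q \<and> t \<le> (m + 1) * unit_cost H \<and> bounded H s' \<and> R s'"
    using 1 by blast
qed

text \<open>The index of the invariant is the termination measure. The loop may exit while it is
  still positive, so the count is only an upper bound; the final 1 pays for the failing
  test.\<close>

lemma wp_While:
  assumes "bsz b \<le> 200"
    and step: "\<And>k s. I k s \<Longrightarrow> bv b s \<Longrightarrow> \<exists>k'. k = Suc k' \<and> wp H c m [] (I k') s"
    and exit: "\<And>k s. I k s \<Longrightarrow> \<not> bv b s \<Longrightarrow> R s"
    and "I k s"
  shows "wp H (WhileC b c) (k * (m + 1) + 1) [] R s"
  using assms(4)
proof (induction k arbitrary: s rule: less_induct)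
  case (less k)
  show ?case unfolding wp_def
  proof
    assume bd: "bounded H s"
    obtain v cb where v: "bval b s = (v, cb)" by force
    have cb: "cb + 2 \<le> unit_cost H" using bval_cost[OF bd assms(1)] v by simp
    show "\<exists>s' t. big (WhileC b c) s s' t [] \<and> t \<le> (k * (m + 1) + 1) * unit_cost H \<and> bounded H s' \<and> R s'"
    proof (cases v)
      case False
      hence "big (WhileC b c) s s (cb + 1) []" using v by (intro big.WhileF) simp
      moreover have "R s" using exit[OF less.prems] False v by (simp add: bv_def)
      moreover have "cb + 1 \<le> (k * (m + 1) + 1) * unit_cost H" using cb by simp
      ultimately show ?thesis using bd by blast
    next
      case True
      then obtain k' where k: "k = Suc k'" and "wp H c m [] (I k') s"
        using step[OF less.prems] v by (auto simp: bv_def)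
      then obtain s1 t1 where 1: "big c s s1 t1 []" "t1 \<le> m * unit_cost H" "bounded H s1" "I k' s1"
        using bd unfolding wp_def by blast
      then obtain s2 t2 where 2: "big (WhileC b c) s1 s2 t2 []"
        "t2 \<le> (k' * (m + 1) + 1) * unit_cost H" "bounded H s2" "R s2"
        using less.IH[of k' s1] k unfolding wp_def by blast
      have "big (WhileC b c) s s2 (cb + t1 + t2 + 1) []"
        using big.WhileT[where b = b and cb = cb, OF _ 1(1) 2(1)] v True by simp
      moreover have "cb + t1 + t2 + 1 \<le> unit_cost H + m * unit_cost H + (k' * (m + 1) + 1) * unit_cost H"
        using cb 1 2 by linarith
      hence "cb + t1 + t2 + 1 \<le> (k * (m + 1) + 1) * unit_cost H"
        by (simp add: k algebra_simps)
      ultimately show ?thesis using 2 by blast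
    qed
  qed
qed

lemma wp_For:
  assumes "bsz b \<le> 200"
    and guard: "\<And>t s. t \<le> l \<Longrightarrow> I t s \<Longrightarrow> bv b s \<longleftrightarrow> t < l"
    and step: "\<And>t s. t < l \<Longrightarrow> I t s \<Longrightarrow> wp H c m [] (I (Suc t)) s"
    and exit: "\<And>s. I l s \<Longrightarrow> R s"
    and init: "I 0 s"
    and steps: "l * (m + 1) + 1 = w"
  shows "wp H (WhileC b c) w [] R s"
  unfolding steps[symmetric]
\<comment> \<open>\<open>wp_While\<close> counts the iterations that remain, \<open>I\<close> those
  already done, hence \<open>l - k\<close>.\<close>
proof (rule wp_While[where I = "\<lambda>k s. k \<le> l \<and> I (l - k) s"])
  fix k s assume k: "k \<le> l \<and> I (l - k) s" and "bv b s"
  hence "l - k < l" using guard[of "l - k" s] by simp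
  then obtain k' where k': "k = Suc k'" by (cases k) auto
  have "Suc (l - k) = l - k'" using k k' by linarith
  thus "\<exists>k'. k = Suc k' \<and> wp H c m [] (\<lambda>s. k' \<le> l \<and> I (l - k') s) s"
    using step[of "l - k" s] k k' \<open>l - k < l\<close> by auto
next
  fix k s assume k: "k \<le> l \<and> I (l - k) s" and "\<not> bv b s"
  thus "R s" using guard[of "l - k" s] exit[of s] by (cases k) auto
qed (use assms in auto)

lemma wp_Oracle:
  assumes "asz a \<le> 200" "1 \<le> s (nat (av a s))" "det (query_mat s (nat (av a s))) \<noteq> 0"
    "k = nat (s (nat (av a s)))"
    "\<bar>\<lfloor>(lambda1 (query_mat s (nat (av a s))))\<^sup>2\<rfloor>\<bar> \<le> H"
    "R (s(nat (av a s) := \<lfloor>(lambda1 (query_mat s (nat (av a s))))\<^sup>2\<rfloor>))"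
  shows "wp H (OracleC a) 1 [k] R s"
  unfolding wp_def
proof
  assume b: "bounded H s"
  obtain x c where xc: "aval a s = (x, c)" by force
  hence x: "x = av a s" by (simp add: av_def)
  have "c + 1 \<le> 1 * unit_cost H"
    using aval_cost[OF b assms(1)] xc by (simp add: unit_cost_def power2_eq_square)
  thus "\<exists>s' t. big (OracleC a) s s' t [k] \<and> t \<le> 1 * unit_cost H \<and> bounded H s' \<and> R s'"
    using big.Oracle[OF xc, of "nat (av a s)"] bounded_upd[OF b assms(5)] assms x by blast
qed

lemma wp_Seq_silent:
  assumes "wp H c1 m1 [] (wp H c2 m2 q R) s" "m1 + m2 = m"
  shows "wp H (Seq c1 c2) m q R s"
  using wp_Seq[OF assms(1)] assms(2) by simp

lemma wp_Store_Seq: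
  assumes "asz a \<le> 200" "asz e \<le> 200" "\<bar>av e s\<bar> \<le> H" "0 < m"
    "wp H c (m - 1) q R (s(nat (av a s) := av e s))"
  shows "wp H (Seq (Store a e) c) m q R s"
proof (rule wp_Seq_silent)
  show "wp H (Store a e) 1 [] (wp H c (m - 1) q R) s" using assms by (intro wp_Store) auto
qed (use assms in simp)

lemma wp_Seq_after:
  assumes "wp H c1 m1 q1 P s" "\<And>s. P s \<Longrightarrow> wp H c2 m2 q2 R s"
  shows "wp H (Seq c1 c2) (m1 + m2) (q1 @ q2) R s"
  using assms by (intro wp_Seq) (simp add: wp_def, blast)

lemma wp_mono:
  assumes "wp H c m q R s" "m \<le> m'" "\<And>s. bounded H s \<Longrightarrow> R s \<Longrightarrow> R' s"
  shows "wp H c m' q R' s"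
  using assms mult_right_mono[OF assms(2), of "unit_cost H"] unfolding wp_def
  by (meson le_trans zero_le)

subsection \<open>The algorithm\<close>

text \<open>As the input fills the cells up to \<open>n\<^sup>2\<close>, no constant address is safe for a scratch variable;
  all variables are addressed relative to \<open>n\<^sup>2\<close>, which is recomputed from cell 0. Offsets:
  1 loop counter, 2 \<open>W\<close>, 3 \<open>N\<close>, 4 power of \<open>N\<close>, 5 \<open>K\<close>, 6 and 7 bisection bounds (6 is then
  consumed digit by digit), 8 \<open>L\<^sup>2\<close>, 9 dimension cell of the query and oracle answer,
  10 onwards the query matrix, followed by the decoded coordinates.\<close>

definition reg :: "nat \<Rightarrow> aexp" where
  "reg c = Add (Mul (Load (Const 0)) (Load (Const 0))) (Const (int c))"

definition val :: "nat \<Rightarrow> aexp" where "val c = Load (reg c)"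
definition dim2 :: aexp where "dim2 = Mul (Load (Const 0)) (Load (Const 0))"
definition inp :: "aexp \<Rightarrow> aexp" where "inp e = Add (Const 1) e"
definition qry :: "aexp \<Rightarrow> aexp" where "qry e = Add (reg 10) e"
definition crd :: "aexp \<Rightarrow> aexp" where "crd e = Add (Add (reg 10) dim2) e"
definition incr :: com where "incr = Store (reg 1) (Add (val 1) (Const 1))"

definition prod_loop :: com where
  "prod_loop = WhileC (Less (val 1) dim2)
     (Seq (Store (reg 2) (Mul (val 2) (Add (Const 1) (Mul (Load (inp (val 1))) (Load (inp (val 1)))))))
     incr)"

definition power_loop :: com where
  "power_loop = WhileC (Less (val 1) (Load (Const 0)))
     (Seq (Store (qry (val 1)) (val 4))
     (Seq (Store (reg 4) (Mul (val 4) (val 3))) incr))"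

definition scale_loop :: com where
  "scale_loop = WhileC (Less (val 1) dim2)
     (Seq (Store (qry (val 1)) (Add (Load (qry (val 1))) (Mul (val 5) (Load (inp (val 1)))))) incr)"

definition mid :: aexp where "mid = Dv (Add (val 6) (val 7)) (Const 2)"

definition sqrt_loop :: com where
  "sqrt_loop = WhileC (Less (Const 1) (Sub (val 7) (val 6)))
     (IfC (Less (val 8) (Mul mid mid)) (Store (reg 7) mid) (Store (reg 6) mid))"

text \<open>Adding \<open>W\<^sup>2\<close>, half of \<open>N - 1\<close>, turns balanced digits into ordinary ones.\<close>

definition shifted :: aexp where "shifted = Add (val 6) (Mul (val 2) (val 2))"

definition digit_loop :: com where
  "digit_loop = WhileC (Less (val 1) (Load (Const 0)))
     (Seq (Store (crd (val 1)) (Sub (Md shifted (val 3)) (Mul (val 2) (val 2))))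
     (Seq (Store (reg 6) (Dv shifted (val 3)))
     (Seq (Store (inp (val 1)) (Const 0)) incr)))"

text \<open>The result accumulates in the output cells, which originally held the first row of
  \<open>B\<close>. The entries are therefore read back from the query matrix, as quotients by
  \<open>K\<close>.\<close>

definition mult_loop :: com where
  "mult_loop = WhileC (Less (val 1) dim2)
     (Seq (Store (inp (Dv (val 1) (Load (Const 0))))
       (Add (Load (inp (Dv (val 1) (Load (Const 0)))))
            (Mul (Dv (Load (qry (val 1))) (val 5)) (Load (crd (Md (val 1) (Load (Const 0)))))))) incr)"

definition multiply :: com where
  "multiply = Seq (Store (reg 1) (Const 0)) mult_loop"

definition decode :: com where
  "decode = Seq (Store (reg 1) (Const 0)) (Seq digit_loop multiply)"

definition recover :: com where
  "recover = Seq (Store (reg 8) (Md (val 9) (val 5))) (Seq (Store (reg 6) (Const 0))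
     (Seq (Store (reg 7) (val 5)) (Seq sqrt_loop decode)))"

definition ask :: com where
  "ask = Seq (Store (reg 9) (Load (Const 0))) (Seq (OracleC (reg 9)) recover)"

definition scale :: com where
  "scale = Seq (Store (reg 5) (Mul (Mul (val 4) (val 4)) (Mul (Mul (val 3) (val 3)) (val 3))))
     (Seq (Store (reg 1) (Const 0)) (Seq scale_loop ask))"

definition perturb :: com where
  "perturb = Seq (Store (reg 3) (Add (Mul (Const 2) (Mul (val 2) (val 2))) (Const 1)))
     (Seq (Store (reg 4) (Const 1)) (Seq (Store (reg 1) (Const 0)) (Seq power_loop scale)))"

text \<open>Memory beyond the input starts at zero. Hence \<open>prod_loop\<close> is entered
  without resetting its counter, and query cells outside the first row need no initialisation.
  Starting the product at \<open>n\<close> makes it end at \<open>W\<close>.\<close>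

definition svp_search :: com where
  "svp_search = Seq (Store (reg 2) (Load (Const 0))) (Seq prod_loop perturb)"

lemmas exp_defs = reg_def val_def dim2_def inp_def qry_def crd_def mid_def shifted_def

subsection \<open>Correctness and running time\<close>

lemma prod_div_mod:
  fixes f :: "nat \<Rightarrow> nat \<Rightarrow> 'a::comm_monoid_mult"
  shows "(\<Prod>u<k * l. f (u div l) (u mod l)) = (\<Prod>i<k. \<Prod>j<l. f i j)"
proof (induction k)
  case (Suc k)
  have "(\<Prod>u<Suc k * l. f (u div l) (u mod l)) =
      (\<Prod>u<k * l. f (u div l) (u mod l)) * (\<Prod>u=k * l..<k * l + l. f (u div l) (u mod l))"
    by (simp add: prod.nat_group[symmetric] add.commute lessThan_atLeast0 prod.atLeastLessThan_concat)
  also have "(\<Prod>u=k * l..<k * l + l. f (u div l) (u mod l)) = (\<Prod>j<l. f k j)"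
    by (rule prod.reindex_bij_witness[of _ "\<lambda>u. u - k * l" "\<lambda>j. k * l + j", symmetric]) auto
  finally show ?case using Suc by simp
qed simp

lemma sum_div_mod:
  fixes f :: "nat \<Rightarrow> nat \<Rightarrow> 'a::comm_monoid_add"
  shows "(\<Sum>u<k * l. f (u div l) (u mod l)) = (\<Sum>i<k. \<Sum>j<l. f i j)"
proof (induction k)
  case (Suc k)
  have "(\<Sum>u<Suc k * l. f (u div l) (u mod l)) =
      (\<Sum>u<k * l. f (u div l) (u mod l)) + (\<Sum>u=k * l..<k * l + l. f (u div l) (u mod l))"
    by (simp add: add.commute lessThan_atLeast0 sum.atLeastLessThan_concat)
  also have "(\<Sum>u=k * l..<k * l + l. f (u div l) (u mod l)) = (\<Sum>j<l. f k j)"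
    by (rule sum.reindex_bij_witness[of _ "\<lambda>u. u - k * l" "\<lambda>j. k * l + j", symmetric]) auto
  finally show ?case using Suc by simp
qed simp

context svp_instance
begin

section \<open>Memory contents in terms of the lattice instance\<close>

definition m :: nat where "m = n * n"
definition b :: "nat \<Rightarrow> int" where "b u = B $$ (u div n, u mod n)"
definition H :: int where "H = K ^ 4"
text \<open>The entries of \<open>B'\<close> in row-major order; \<open>u < n\<close> singles out
  row 0.\<close>

definition q :: "nat \<Rightarrow> int" where "q u = (if u < n then N ^ u else 0) + K * b u"

lemma n_le_m: "n \<le> m" using n_ge_1 by (simp add: m_def)

lemma av_dim2: "s 0 = int n \<Longrightarrow> av dim2 s = int m" by (simp add: dim2_def m_def)

lemma av_reg: "s 0 = int n \<Longrightarrow> av (reg c) s = int m + int c" by (simp add: reg_def m_def)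

lemma av_val: "s 0 = int n \<Longrightarrow> av (val c) s = s (m + c)"
  by (simp add: val_def av_reg nat_add_distrib)

lemma asz_simps [simp]:
  "asz (reg c) = 7 + c" "asz (val c) = 8 + c" "asz dim2 = 5" "asz (inp e) = asz e + 3"
  "asz (qry e) = asz e + 18" "asz (crd e) = asz e + 24" "asz mid = 34" "asz shifted = 36"
  by (auto simp: exp_defs)

lemmas av_exp = av_dim2 av_reg av_val inp_def qry_def crd_def nat_add_distrib

text \<open>The conjunct on cells above \<open>m + 2\<close> preserves the initial zeros, which
  later serve as the blank query matrix.\<close>

definition inv_prod :: "nat \<Rightarrow> mem \<Rightarrow> bool" where
  "inv_prod t s \<longleftrightarrow> s 0 = int n \<and> (\<forall>u<m. s (Suc u) = b u) \<and> s (m + 1) = int t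
     \<and> s (m + 2) = int n * (\<Prod>u<t. 1 + (b u)\<^sup>2) \<and> (\<forall>a>m + 2. s a = 0)"

definition inv_power :: "nat \<Rightarrow> mem \<Rightarrow> bool" where
  "inv_power t s \<longleftrightarrow> s 0 = int n \<and> (\<forall>u<m. s (Suc u) = b u) \<and> s (m + 1) = int t
     \<and> s (m + 2) = W \<and> s (m + 3) = N \<and> s (m + 4) = N ^ t
     \<and> (\<forall>j. s (m + 10 + j) = (if j < t then N ^ j else 0))"

definition inv_scale :: "nat \<Rightarrow> mem \<Rightarrow> bool" where
  "inv_scale t s \<longleftrightarrow> s 0 = int n \<and> (\<forall>u<m. s (Suc u) = b u) \<and> s (m + 1) = int t
     \<and> s (m + 2) = W \<and> s (m + 3) = N \<and> s (m + 5) = K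
     \<and> (\<forall>u<m. s (m + 10 + u) = (if u < n then N ^ u else 0) + (if u < t then K * b u else 0))"

text \<open>The data that survive from the query to the end. The input cells are left out because
  the output overwrites some of them.\<close>

definition tables :: "mem \<Rightarrow> bool" where
  "tables s \<longleftrightarrow> s 0 = int n \<and> s (m + 2) = W \<and> s (m + 3) = N \<and> s (m + 5) = K
     \<and> (\<forall>u<m. s (m + 10 + u) = q u)"

text \<open>\<open>k\<close> bounds the halvings still to come: a gap of at most
  \<open>2 ^ 0\<close> forces the lower end to be \<open>l\<close>. Bisection from 0 and
  \<open>K\<close> thus takes at most \<open>sz K\<close> rounds.\<close>

definition inv_sqrt :: "int \<Rightarrow> nat \<Rightarrow> mem \<Rightarrow> bool" where
  "inv_sqrt l k s \<longleftrightarrow> tables s \<and> s (m + 8) = l\<^sup>2 \<and> 0 \<le> s (m + 6) \<and> s (m + 6) \<le> l \<and> l < s (m + 7)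
     \<and> s (m + 7) \<le> K \<and> s (m + 7) - s (m + 6) \<le> 2 ^ k"

text \<open>After \<open>t\<close> digits cell \<open>m + 6\<close> holds the quotient of
  \<open>L x\<close> that still contains the digits from position \<open>t\<close> on. Clearing the
  output cells along the way prepares the accumulators of \<open>mult_loop\<close>.\<close>

definition inv_digit :: "int vec \<Rightarrow> nat \<Rightarrow> mem \<Rightarrow> bool" where
  "inv_digit x t s \<longleftrightarrow> tables s \<and> s (m + 1) = int t \<and> s (m + 6) = (\<Sum>j<n - t. N ^ j * x $ (t + j))
     \<and> (\<forall>j<t. s (m + 10 + m + j) = x $ j) \<and> (\<forall>j<t. s (Suc j) = 0)"

definition inv_mult :: "int vec \<Rightarrow> nat \<Rightarrow> mem \<Rightarrow> bool" where
  "inv_mult x t s \<longleftrightarrow> tables s \<and> s (m + 1) = int t \<and> (\<forall>j<n. s (m + 10 + m + j) = x $ j)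
     \<and> (\<forall>i<n. s (Suc i) = (\<Sum>u<t. if u div n = i then b u * x $ (u mod n) else 0))"

section \<open>Magnitudes of stored values\<close>

lemma K_ge_1: "1 \<le> K" using K_ge N_ge_3 W_ge_1 by (smt (verit) mult_nonneg_nonneg zero_le_power)

lemma K_pow_le_H: "i \<le> 4 \<Longrightarrow> K ^ i \<le> H"
  unfolding H_def by (intro power_increasing K_ge_1)

lemma le_K_le_H: "\<bar>z\<bar> \<le> K \<Longrightarrow> \<bar>z\<bar> \<le> H" using K_pow_le_H[of 1] by simp

lemma N_pow_le_K:
  assumes "t \<le> n"
  shows "N ^ t * N ^ 3 \<le> K"
proof -
  have "N ^ t * 1 \<le> N ^ n * N ^ n" using assms N_ge_3 by (intro mult_mono power_increasing) auto
  thus ?thesis unfolding K_def using N_ge_3 by (intro mult_right_mono) auto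
qed

lemma N_cube_le_K: "N ^ 3 \<le> K" using N_pow_le_K[of 0] by simp

lemma N_le_K: "N \<le> K" using N_cube_le_K N_ge_3 self_le_power[of N 3] by simp

lemma N_pow_less_K:
  assumes "t \<le> n" shows "N ^ t < K"
proof -
  have "N ^ t * 1 < N ^ t * N ^ 3" using N_ge_3 by (intro mult_strict_left_mono) auto
  thus ?thesis using N_pow_le_K[OF assms] by linarith
qed

lemma m_less_N: "int m < N"
proof -
  have "int n * int n \<le> W * W" using n_le_W by (intro mult_mono) auto
  moreover have "0 \<le> W * W" by simp
  ultimately show ?thesis unfolding N_def m_def power2_eq_square of_nat_mult by linarith
qed

lemma abs_b_le_W: "u < m \<Longrightarrow> \<bar>b u\<bar> \<le> W"
  unfolding b_def m_def using n_ge_1 by (intro abs_entry_le_W) (auto simp: less_mult_imp_div_less)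

lemma partial_prod_le_W:
  assumes "t \<le> m"
  shows "int n * (\<Prod>u<t. 1 + (b u)\<^sup>2) \<le> W"
proof -
  have "(\<Prod>u<t. 1 + (b u)\<^sup>2) \<le> (\<Prod>u<m. 1 + (b u)\<^sup>2)" using assms by (intro prod_mono2) auto
  also have "\<dots> = entry_prod B"
    using B by (simp add: b_def m_def entry_prod_def prod_div_mod[of "\<lambda>i j. 1 + (B $$ (i, j))\<^sup>2"])
  finally show ?thesis by (simp add: W_def mult_left_mono)
qed

lemma W_eq_prod: "W = int n * (\<Prod>u<m. 1 + (b u)\<^sup>2)"
  using B by (simp add: W_def b_def m_def entry_prod_def prod_div_mod[of "\<lambda>i j. 1 + (B $$ (i, j))\<^sup>2"])

section \<open>Correctness of the individual loops\<close>

lemma prod_loop_correct: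
  assumes "inv_prod 0 s"
  shows "wp H prod_loop (m * 3 + 1) [] (inv_prod m) s"
  unfolding prod_loop_def incr_def
proof (rule wp_For[where l = m and m = 2 and I = inv_prod])
  fix t s assume "t \<le> m" "inv_prod t s"
  thus "bv (Less (val 1) dim2) s = (t < m)" by (simp add: inv_prod_def av_exp)
next
  fix t s assume t: "t < m" and I: "inv_prod t s"
  have s0: "s 0 = int n" and ct: "s (m + 1) = int t" and bt: "s (Suc t) = b t" using I t by (auto simp: inv_prod_def)
  have p: "s (m + 2) * (1 + b t * b t) = int n * (\<Prod>u<Suc t. 1 + (b u)\<^sup>2)"
    using I by (simp add: inv_prod_def power2_eq_square)
  have "0 \<le> int n * (\<Prod>u<Suc t. 1 + (b u)\<^sup>2)" by (intro mult_nonneg_nonneg prod_nonneg) auto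
  hence pH: "\<bar>s (m + 2) * (1 + b t * b t)\<bar> \<le> H"
    unfolding p using partial_prod_le_W[of "Suc t"] t W_less_N W_ge_1 N_le_K by (intro le_K_le_H) linarith
  have tH: "\<bar>1 + int t\<bar> \<le> H" using t m_less_N N_le_K by (intro le_K_le_H) linarith
  show "wp H (Seq (Store (reg 2) (Mul (val 2) (Add (Const 1) (Mul (Load (inp (val 1))) (Load (inp (val 1)))))))
       (Store (reg 1) (Add (val 1) (Const 1)))) 2 [] (inv_prod (Suc t)) s"
    using s0 ct bt pH tH I t p
    by (intro wp_Store_Seq wp_Store) (auto simp: av_exp inv_prod_def add.commute simp del: prod.lessThan_Suc)
qed (use assms in auto)

lemma N_pow_nonneg: "0 \<le> N ^ t" using N_ge_3 by simp

lemma counter_le_H: "t \<le> m \<Longrightarrow> \<bar>int t + 1\<bar> \<le> H"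
  using m_less_N N_le_K by (intro le_K_le_H) linarith

lemma index_le_H: "t \<le> n \<Longrightarrow> \<bar>int t + 1\<bar> \<le> H"
  using counter_le_H n_le_m by simp

lemma N_pow_le_H: "t \<le> n \<Longrightarrow> \<bar>N ^ t\<bar> \<le> H"
  using N_pow_less_K[of t] N_pow_nonneg[of t] by (intro le_K_le_H) simp

lemma power_loop_correct:
  assumes "inv_power 0 s"
  shows "wp H power_loop (n * 4 + 1) [] (inv_power n) s"
  unfolding power_loop_def incr_def
proof (rule wp_For[where l = n and m = 3 and I = inv_power])
  fix t s assume "t \<le> n" "inv_power t s"
  thus "bv (Less (val 1) (Load (Const 0))) s = (t < n)" by (simp add: inv_power_def av_exp)
next
  fix t s assume t: "t < n" and I: "inv_power t s"
  show "wp H (Seq (Store (qry (val 1)) (val 4))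
     (Seq (Store (reg 4) (Mul (val 4) (val 3))) (Store (reg 1) (Add (val 1) (Const 1))))) 3 [] (inv_power (Suc t)) s"
    using t I index_le_H[of t] N_pow_le_H[of t] N_pow_le_H[of "Suc t"]
    by (intro wp_Store_Seq wp_Store) (auto simp: av_exp inv_power_def mult.commute)
qed (use assms in auto)

lemma scale_loop_correct:
  assumes "inv_scale 0 s"
  shows "wp H scale_loop (m * 3 + 1) [] (inv_scale m) s"
  unfolding scale_loop_def incr_def
proof (rule wp_For[where l = m and m = 2 and I = inv_scale])
  fix t s assume "t \<le> m" "inv_scale t s"
  thus "bv (Less (val 1) dim2) s = (t < m)" by (simp add: inv_scale_def av_exp)
next
  fix t s assume t: "t < m" and I: "inv_scale t s"
  let ?e = "if t < n then N ^ t else 0"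
  have "\<bar>?e\<bar> \<le> K" using N_pow_less_K[of t] N_pow_nonneg[of t] K_ge_1 by auto
  moreover have "\<bar>b t\<bar> \<le> K" using abs_b_le_W[OF t] W_less_N W_ge_1 N_le_K by linarith
  hence "\<bar>K * b t\<bar> \<le> K * K" using K_ge_1 by (simp add: abs_mult)
  moreover have "K + K * K \<le> H"
  proof -
    have "3 \<le> K" using N_ge_3 N_le_K by linarith
    hence "K * 1 \<le> K * K" "2 * (K * K) \<le> K * (K * K)" by (intro mult_left_mono mult_right_mono; simp)+
    thus ?thesis using K_pow_le_H[of 3] by (simp add: power3_eq_cube)
  qed
  ultimately have "\<bar>?e + K * b t\<bar> \<le> H" by linarith
  thus "wp H (Seq (Store (qry (val 1)) (Add (Load (qry (val 1))) (Mul (val 5) (Load (inp (val 1))))))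
      (Store (reg 1) (Add (val 1) (Const 1)))) 2 [] (inv_scale (Suc t)) s"
    using t I counter_le_H[of t]
    by (intro wp_Store_Seq wp_Store) (auto simp: av_exp inv_scale_def)
qed (use assms in auto)

lemma sqrt_loop_correct:
  assumes "inv_sqrt l k s"
  shows "wp H sqrt_loop (k * 3 + 1) [] (\<lambda>s. tables s \<and> s (m + 6) = l) s"
proof -
  have "wp H sqrt_loop (k * (2 + 1) + 1) [] (\<lambda>s. tables s \<and> s (m + 6) = l) s"
    unfolding sqrt_loop_def
  proof (rule wp_While[where I = "inv_sqrt l"])
    fix k s assume I: "inv_sqrt l k s" and g: "bv (Less (Const 1) (Sub (val 7) (val 6))) s"
    have s0: "s 0 = int n" using I by (simp add: inv_sqrt_def tables_def)
    have gap: "1 < s (m + 7) - s (m + 6)" using g s0 by (simp add: av_exp)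
    then obtain k' where k: "k = Suc k'" using I by (cases k) (auto simp: inv_sqrt_def)
    define c where "c = (s (m + 6) + s (m + 7)) div 2"
    have c: "av mid s = c" by (simp add: mid_def c_def av_exp s0)
    have c1: "s (m + 6) < c" "c < s (m + 7)" "2 * c \<le> s (m + 6) + s (m + 7)" "s (m + 6) + s (m + 7) \<le> 2 * c + 1"
      using gap unfolding c_def by linarith+
    \<comment> \<open>The bound on the gap is even, so it survives the rounding of the midpoint:
      both halves have length at most \<open>2 ^ k'\<close>.\<close>
    have gap2: "s (m + 7) - s (m + 6) \<le> 2 * 2 ^ k'" using I k by (simp add: inv_sqrt_def)
    have cH: "\<bar>c\<bar> \<le> H" using c1 I by (intro le_K_le_H) (auto simp: inv_sqrt_def)
    have "l\<^sup>2 < c * c \<longleftrightarrow> l < c"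
    proof -
      have "0 \<le> l" "0 \<le> c" using I c1 by (auto simp: inv_sqrt_def)
      thus ?thesis using power_mono[of c l 2] power_strict_mono[of l c 2]
        by (auto simp: power2_eq_square not_less[symmetric])
    qed
    hence cmp: "bv (Less (val 8) (Mul mid mid)) s \<longleftrightarrow> l < c" using I by (simp add: av_exp c s0 inv_sqrt_def)
    have "wp H (IfC (Less (val 8) (Mul mid mid)) (Store (reg 7) mid) (Store (reg 6) mid)) (1 + 1) [] (inv_sqrt l k') s"
      unfolding cmp[symmetric] using I c1 gap2 cH cmp
      by (intro wp_If wp_Store) (auto simp: av_exp c s0 inv_sqrt_def tables_def)
    thus "\<exists>k'. k = Suc k' \<and> wp H (IfC (Less (val 8) (Mul mid mid)) (Store (reg 7) mid) (Store (reg 6) mid)) 2 [] (inv_sqrt l k') s"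
      using k by (auto simp: numeral_2_eq_2)
  next
    fix k s assume I: "inv_sqrt l k s" and "\<not> bv (Less (Const 1) (Sub (val 7) (val 6))) s"
    thus "tables s \<and> s (m + 6) = l" by (auto simp: inv_sqrt_def tables_def av_exp)
  qed (use assms in auto)
  thus ?thesis by simp
qed

text \<open>The shifted digit lies in the range from 0 to \<open>N - 1\<close> and all later terms
  are multiples of \<open>N\<close>, so ordinary \<open>mod\<close> and \<open>div\<close> separate
  the digit from the tail.\<close>

lemma digit_step:
  assumes x: "\<And>k. k < n \<Longrightarrow> \<bar>x $ k\<bar> \<le> W\<^sup>2" and t: "t < n"
  defines "S \<equiv> (\<Sum>j<n - t. N ^ j * x $ (t + j)) + W\<^sup>2"
  shows "S mod N = x $ t + W\<^sup>2" "S div N = (\<Sum>j<n - Suc t. N ^ j * x $ (Suc t + j))"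
proof -
  let ?r = "\<Sum>j<n - Suc t. N ^ j * x $ (Suc t + j)"
  have "n - t = Suc (n - Suc t)" using t by simp
  hence S: "S = x $ t + W\<^sup>2 + N * ?r"
    unfolding S_def by (simp add: sum.lessThan_Suc_shift sum_distrib_left mult.assoc del: sum.lessThan_Suc)
  have "0 \<le> x $ t + W\<^sup>2" "x $ t + W\<^sup>2 < N" using x[OF t] W_sq_less_N by linarith+
  thus "S mod N = x $ t + W\<^sup>2" "S div N = ?r" unfolding S using N_ge_3 by simp_all
qed

lemma tail_sum_le_K:
  assumes x: "\<And>k. k < n \<Longrightarrow> \<bar>x $ k\<bar> \<le> W\<^sup>2"
  shows "\<bar>\<Sum>j<n - t. N ^ j * x $ (t + j)\<bar> \<le> K"
proof -
  have "\<bar>\<Sum>j<n - t. N ^ j * x $ (t + j)\<bar> \<le> (\<Sum>j<n - t. N ^ j * W\<^sup>2)"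
    using x N_ge_3 by (intro order_trans[OF sum_abs] sum_mono) (auto simp: abs_mult intro!: mult_left_mono)
  also have "\<dots> = (\<Sum>j<n - t. N ^ j) * W\<^sup>2" by (rule sum_distrib_right[symmetric])
  also have "\<dots> \<le> N ^ (n - t) * N"
    using N_ge_3 W_sq_less_N sum_powers_le[of N "n - t"] by (intro mult_mono) auto
  also have "\<dots> \<le> N ^ (n - t) * N ^ 3"
    using N_ge_3 self_le_power[of N 3] by (intro mult_left_mono) auto
  also have "\<dots> \<le> K" by (rule N_pow_le_K) simp
  finally show ?thesis .
qed

lemma digit_loop_correct:
  assumes x: "\<And>k. k < n \<Longrightarrow> \<bar>x $ k\<bar> \<le> W\<^sup>2" and "inv_digit x 0 s"
  shows "wp H digit_loop (n * 5 + 1) [] (inv_digit x n) s"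
  unfolding digit_loop_def incr_def
proof (rule wp_For[where l = n and m = 4 and I = "inv_digit x"])
  fix t s assume "t \<le> n" "inv_digit x t s"
  thus "bv (Less (val 1) (Load (Const 0))) s = (t < n)" by (simp add: inv_digit_def tables_def av_exp)
next
  fix t s assume t: "t < n" and I: "inv_digit x t s"
  have s0: "s 0 = int n" and i: "s (m + 1) = int t" and w: "s (m + 2) = W" and r3: "s (m + 3) = N"
    using I by (auto simp: inv_digit_def tables_def)
  define l where "l = (\<Sum>j<n - Suc t. N ^ j * x $ (Suc t + j))"
  have r6: "s (m + 6) + W * W = (\<Sum>j<n - t. N ^ j * x $ (t + j)) + W\<^sup>2"
    using I by (simp add: inv_digit_def power2_eq_square)
  have e: "(s (m + 6) + W * W) mod N = x $ t + W * W" "(s (m + 6) + W * W) div N = l"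
    unfolding r6 using digit_step[OF x t] by (auto simp: power2_eq_square l_def)
  have "\<bar>x $ t\<bar> \<le> H" using x[OF t] W_sq_less_N N_le_K by (intro le_K_le_H) linarith
  moreover have "\<bar>l\<bar> \<le> H" unfolding l_def by (intro le_K_le_H tail_sum_le_K x)
  moreover have "0 \<le> H" using K_pow_le_H[of 0] by simp
  moreover have "t < m" using t n_le_m by simp
  moreover have "inv_digit x (Suc t) (s(m + 10 + m + t := x $ t, m + 6 := l, Suc t := 0, m + 1 := int t + 1))"
    (is "inv_digit x _ ?s")
  proof -
    have "tables ?s" using I t n_le_m by (simp add: inv_digit_def tables_def)
    moreover have "\<forall>j<Suc t. ?s (m + 10 + m + j) = x $ j"
      using I by (auto simp: inv_digit_def less_Suc_eq)
    moreover have "\<forall>j<Suc t. ?s (Suc j) = 0"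
      using I t n_le_m by (auto simp: inv_digit_def less_Suc_eq)
    ultimately show ?thesis using t n_le_m by (simp add: inv_digit_def l_def)
  qed
  ultimately show "wp H (Seq (Store (crd (val 1)) (Sub (Md shifted (val 3)) (Mul (val 2) (val 2))))
     (Seq (Store (reg 6) (Dv shifted (val 3)))
     (Seq (Store (inp (val 1)) (Const 0)) (Store (reg 1) (Add (val 1) (Const 1)))))) 4 [] (inv_digit x (Suc t)) s"
    using s0 i w r3 e index_le_H[of t] t
    by (intro wp_Store_Seq wp_Store) (simp_all add: av_exp shifted_def nat_mult_distrib add.commute)
qed (use assms in auto)

text \<open>The perturbation is nonnegative and below \<open>K\<close>, so floor division removes it
  exactly, even when \<open>b u\<close> is negative.\<close>

lemma q_div_K: "q u div K = b u"
proof -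
  have "0 \<le> (if u < n then N ^ u else 0)" "(if u < n then N ^ u else 0) < K"
    using N_pow_less_K[of u] N_pow_nonneg[of u] K_ge_1 by auto
  thus ?thesis unfolding q_def by simp
qed

text \<open>The memory bound concerns every intermediate sum, and cancellation may make these larger
  than the final coordinate; there are at most \<open>K\<close> terms, each at most
  \<open>K * K\<close>.\<close>

lemma partial_mult_le_H:
  assumes x: "\<And>k. k < n \<Longrightarrow> \<bar>x $ k\<bar> \<le> W\<^sup>2" and t: "t \<le> m"
  shows "\<bar>\<Sum>u<t. if u div n = i then b u * x $ (u mod n) else 0\<bar> \<le> H"
proof -
  have "\<bar>\<Sum>u<t. if u div n = i then b u * x $ (u mod n) else 0\<bar> \<le> (\<Sum>u<t. K * K)"
  proof (rule order_trans[OF sum_abs], rule sum_mono)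
    fix u assume "u \<in> {..<t}"
    hence "\<bar>b u\<bar> \<le> K" using abs_b_le_W[of u] t W_less_N W_ge_1 N_le_K by force
    moreover have "\<bar>x $ (u mod n)\<bar> \<le> K"
      using x[of "u mod n"] n_ge_1 W_sq_less_N N_le_K by force
    ultimately have "\<bar>b u\<bar> * \<bar>x $ (u mod n)\<bar> \<le> K * K" by (intro mult_mono) auto
    thus "\<bar>if u div n = i then b u * x $ (u mod n) else 0\<bar> \<le> K * K" by (simp add: abs_mult)
  qed
  also have "\<dots> \<le> K * (K * K)" using t m_less_N N_le_K by (simp add: mult_right_mono)
  also have "\<dots> \<le> H" using K_pow_le_H[of 3] by (simp add: power3_eq_cube)
  finally show ?thesis .
qed

lemma mult_loop_correct:
  assumes x: "\<And>k. k < n \<Longrightarrow> \<bar>x $ k\<bar> \<le> W\<^sup>2" and "inv_mult x 0 s"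
  shows "wp H mult_loop (m * 3 + 1) [] (inv_mult x m) s"
  unfolding mult_loop_def incr_def
proof (rule wp_For[where l = m and m = 2 and I = "inv_mult x"])
  fix t s assume "t \<le> m" "inv_mult x t s"
  thus "bv (Less (val 1) dim2) s = (t < m)" by (simp add: inv_mult_def tables_def av_exp)
next
  fix t s assume t: "t < m" and I: "inv_mult x t s"
  have s0: "s 0 = int n" and i: "s (m + 1) = int t" and k: "s (m + 5) = K" and qt: "s (m + 10 + t) = q t"
    using I t by (auto simp: inv_mult_def tables_def)
  define d r where "d = t div n" and "r = t mod n"
  have d: "d < n" using t by (simp add: d_def m_def less_mult_imp_div_less)
  have r: "r < n" using n_ge_1 by (simp add: r_def)
  have xr: "s (m + 10 + m + r) = x $ r" using I r by (simp add: inv_mult_def)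
  have dm: "d < m" using d n_le_m by simp
  let ?S = "\<lambda>t i. \<Sum>u<t. if u div n = i then b u * x $ (u mod n) else 0"
  have sd: "s (Suc d) + b t * x $ r = ?S (Suc t) d" using I d by (simp add: inv_mult_def d_def r_def)
  have sH: "\<bar>s (Suc d) + b t * x $ r\<bar> \<le> H" unfolding sd using t by (intro partial_mult_le_H x) auto
  have div: "nat (int t div int n) = d" "nat (int t mod int n) = r"
    by (simp_all add: d_def r_def nat_div_distrib nat_mod_distrib)
  have nn: "0 \<le> int t div int n" "0 \<le> int t mod int n" using n_ge_1 by (auto simp: pos_imp_zdiv_nonneg_iff)
  have fin: "inv_mult x (Suc t) (s(Suc d := s (Suc d) + b t * x $ r, m + 1 := int t + 1))"
    (is "inv_mult x _ ?s")
  proof -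
    have "tables ?s" using I dm by (simp add: inv_mult_def tables_def)
    moreover have "\<forall>j<n. ?s (m + 10 + m + j) = x $ j" using I dm by (simp add: inv_mult_def)
    moreover have "?s (Suc i) = ?S (Suc t) i" if "i < n" for i
    proof (cases "i = d")
      case True
      thus ?thesis using sd dm by (simp del: sum.lessThan_Suc)
    next
      case False
      hence "?s (Suc i) = s (Suc i)" using that n_le_m by simp
      also have "\<dots> = ?S t i" using I that by (simp add: inv_mult_def)
      also have "\<dots> = ?S (Suc t) i" using False by (simp add: d_def)
      finally show ?thesis .
    qed
    ultimately show ?thesis by (simp add: inv_mult_def del: sum.lessThan_Suc)
  qed
  show "wp H (Seq (Store (inp (Dv (val 1) (Load (Const 0))))
       (Add (Load (inp (Dv (val 1) (Load (Const 0)))))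
            (Mul (Dv (Load (qry (val 1))) (val 5)) (Load (crd (Md (val 1) (Load (Const 0))))))))
      (Store (reg 1) (Add (val 1) (Const 1)))) 2 [] (inv_mult x (Suc t)) s"
    using s0 i k qt xr dm sH div nn counter_le_H[of t] t fin
    by (intro wp_Store_Seq wp_Store) (simp_all add: av_exp nat_mult_distrib q_div_K add.commute)
qed (use assms in auto)

section \<open>From the input memory to the output vector\<close>

lemma input_mem_props:
  "input_mem n B 0 = int n" "u < m \<Longrightarrow> input_mem n B (Suc u) = b u"
  "m < a \<Longrightarrow> input_mem n B a = 0"
  by (auto simp: input_mem_def m_def b_def)

lemma bounded_input: "bounded H (input_mem n B)"
  unfolding bounded_def
proof
  fix a
  have W: "\<bar>z\<bar> \<le> H" if "\<bar>z\<bar> \<le> W" for z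
    using that W_less_N N_le_K W_ge_1 by (intro le_K_le_H) linarith
  consider "a = 0" | u where "a = Suc u" "u < m" | "m < a"
  proof (cases a)
    case (Suc u)
    thus ?thesis using that by (cases "u < m") auto
  qed (use that in auto)
  thus "\<bar>input_mem n B a\<bar> \<le> H"
    using W[of "int n"] W[of "b _"] abs_b_le_W n_le_W W[of 0] W_ge_1
    by cases (auto simp: input_mem_props)
qed

lemma query_mat_eq_B':
  assumes "s p = int n" "\<And>u. u < m \<Longrightarrow> s (p + 1 + u) = q u"
  shows "query_mat s p = B'"
proof -
  have "s (p + 1 + i * n + j) = K * B $$ (i, j) + (if i = 0 then N ^ j else 0)"
    if ij: "i < n" "j < n" for i j
  proof -
    have "i * n + j < i * n + n" using ij by simp
    also have "\<dots> \<le> m" using ij mult_le_mono1[of "Suc i" n n] by (simp add: m_def)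
    finally have "s (p + 1 + (i * n + j)) = q (i * n + j)" by (rule assms(2))
    moreover have "i * n + j < n \<longleftrightarrow> i = 0" using ij by (cases i) auto
    ultimately show ?thesis using ij by (auto simp: q_def b_def add.assoc)
  qed
  thus ?thesis using assms(1) by (auto simp: query_mat_def B'_def)
qed

lemma output_eq:
  assumes x: "x \<in> carrier_vec n" and I: "inv_mult x m s"
  shows "output_vec n s = B *\<^sub>v x"
proof
  show "dim_vec (output_vec n s) = dim_vec (B *\<^sub>v x)" using B by (simp add: output_vec_def)
  fix i assume "i < dim_vec (B *\<^sub>v x)"
  hence i: "i < n" using B by simp
  have "output_vec n s $ i = (\<Sum>u<n * n. if u div n = i then b u * x $ (u mod n) else 0)"
    using I i by (simp add: output_vec_def inv_mult_def m_def)
  also have "\<dots> = (\<Sum>i'<n. \<Sum>j<n. if i' = i then B $$ (i', j) * x $ j else 0)"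
    unfolding b_def by (rule sum_div_mod)
  also have "\<dots> = (\<Sum>i'<n. if i' = i then y x i else 0)"
    by (intro sum.cong) (auto simp: y_def)
  also have "\<dots> = y x i" using i by simp
  finally show "output_vec n s $ i = (B *\<^sub>v x) $ i" using i x by (simp only: B_mult_nth)
qed

lemma H_ge_1: "1 \<le> H" using K_pow_le_H[of 0] by simp

lemma K_le_H: "\<bar>K\<bar> \<le> H" using K_ge_1 by (intro le_K_le_H) simp

lemma N_le_H: "\<bar>N\<bar> \<le> H" using N_le_K N_ge_3 by (intro le_K_le_H) simp

lemma n_le_H: "int n \<le> H"
  using n_le_W W_less_N W_ge_1 N_le_H by linarith

lemma multiply_correct:
  assumes "inv_digit x n s" "\<And>k. k < n \<Longrightarrow> \<bar>x $ k\<bar> \<le> W\<^sup>2"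
  shows "wp H multiply (m * 3 + 2) [] (inv_mult x m) s"
  unfolding multiply_def
proof (rule wp_Store_Seq)
  have s0: "s 0 = int n" using assms by (simp add: inv_digit_def tables_def)
  have "inv_mult x 0 (s(m + 1 := 0))" using assms by (simp add: inv_mult_def inv_digit_def tables_def)
  from mult_loop_correct[OF assms(2) this]
  show "wp H mult_loop (m * 3 + 2 - 1) [] (inv_mult x m) (s(nat (av (reg 1) s) := av (Const 0) s))"
    by (simp add: av_exp s0)
qed (use H_ge_1 in auto)

lemma decode_correct:
  assumes "tables s" "s (m + 6) = L x" and x: "\<And>k. k < n \<Longrightarrow> \<bar>x $ k\<bar> \<le> W\<^sup>2"
  shows "wp H decode (n * 5 + m * 3 + 4) [] (inv_mult x m) s"
  unfolding decode_def
proof (rule wp_Store_Seq)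
  have s0: "s 0 = int n" using assms by (simp add: tables_def)
  have "inv_digit x 0 (s(m + 1 := 0))" using assms by (simp add: inv_digit_def tables_def L_def)
  note digits = digit_loop_correct[OF x this]
  have "wp H multiply (m * 3 + 2) [] (inv_mult x m) s" if "inv_digit x n s" for s
    using that x by (rule multiply_correct)
  from wp_Seq_after[OF digits this]
  have "wp H (Seq digit_loop multiply) (n * 5 + m * 3 + 3) [] (inv_mult x m) (s(m + 1 := 0))"
    by (simp add: eval_nat_numeral)
  thus "wp H (Seq digit_loop multiply) (n * 5 + m * 3 + 4 - 1) [] (inv_mult x m)
      (s(nat (av (reg 1) s) := av (Const 0) s))"
    by (simp add: av_exp s0 ac_simps)
qed (use H_ge_1 in auto)

lemma recover_correct:
  assumes s: "tables s" and mod: "s (m + 9) mod K = (L x)\<^sup>2" and L: "0 \<le> L x" "L x < K"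
    and x: "\<And>k. k < n \<Longrightarrow> \<bar>x $ k\<bar> \<le> W\<^sup>2"
  shows "wp H recover (sz K * 3 + n * 5 + m * 3 + 8) [] (inv_mult x m) s"
proof -
  have s0: "s 0 = int n" and s5: "s (m + 5) = K" using s by (auto simp: tables_def)
  have "K \<le> 2 ^ sz K" using abs_less_sz[of K] by simp
  hence "inv_sqrt (L x) (sz K) (s(m + 8 := (L x)\<^sup>2, m + 6 := 0, m + 7 := K))"
    using s L by (simp add: inv_sqrt_def tables_def)
  note sqrt = sqrt_loop_correct[OF this]
  have dec: "wp H decode (n * 5 + m * 3 + 4) [] (inv_mult x m) s" if "tables s \<and> s (m + 6) = L x" for s
    using that x by (intro decode_correct) auto
  from wp_Seq_after[OF sqrt dec]
  have run: "wp H (Seq sqrt_loop decode) (sz K * 3 + n * 5 + m * 3 + 5) [] (inv_mult x m)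
      (s(m + 8 := (L x)\<^sup>2, m + 6 := 0, m + 7 := K))"
    by (simp add: ac_simps)
  have "(L x)\<^sup>2 < K" unfolding mod[symmetric] using L by (intro pos_mod_bound) simp
  hence "\<bar>(L x)\<^sup>2\<bar> \<le> H" by (intro le_K_le_H) simp
  thus ?thesis
    unfolding recover_def using run s0 s5 mod H_ge_1 K_le_H
    by (intro wp_Store_Seq) (simp_all add: av_exp ac_simps)
qed

lemma ask_correct:
  assumes I: "inv_scale m s" and mu: "\<bar>\<lfloor>(lambda1 B')\<^sup>2\<rfloor>\<bar> \<le> H"
    and mod: "\<lfloor>(lambda1 B')\<^sup>2\<rfloor> mod K = (L x)\<^sup>2" and L: "0 \<le> L x" "L x < K"
    and x: "\<And>k. k < n \<Longrightarrow> \<bar>x $ k\<bar> \<le> W\<^sup>2"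
  shows "wp H ask (sz K * 3 + n * 5 + m * 3 + 10) [n] (inv_mult x m) s"
  unfolding ask_def
proof (rule wp_Store_Seq)
  have s0: "s 0 = int n" using I by (simp add: inv_scale_def)
  let ?s = "s(m + 9 := int n)"
  let ?P = "\<lambda>s. tables s \<and> s (m + 9) mod K = (L x)\<^sup>2"
  have tab: "tables (s(m + 9 := z))" for z
    using I by (simp add: inv_scale_def tables_def q_def)
  have a9: "nat (av (reg 9) ?s) = m + 9" using s0 by (simp add: av_exp)
  have qm: "query_mat ?s (m + 9) = B'"
    using I by (intro query_mat_eq_B') (auto simp: inv_scale_def q_def add.commute)
  have "wp H (OracleC (reg 9)) 1 [n] ?P ?s"
    using n_ge_1 det_B' mu mod tab
    by (intro wp_Oracle) (simp_all add: a9 qm del: One_nat_def)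
  from wp_Seq_after[OF this recover_correct[OF _ _ L x]]
  have "wp H (Seq (OracleC (reg 9)) recover) (1 + (sz K * 3 + n * 5 + m * 3 + 8)) [n] (inv_mult x m) ?s"
    by simp
  thus "wp H (Seq (OracleC (reg 9)) recover) (sz K * 3 + n * 5 + m * 3 + 10 - 1) [n] (inv_mult x m)
      (s(nat (av (reg 9) s) := av (Load (Const 0)) s))"
    by (simp add: av_exp s0)
qed (use I n_le_H in \<open>auto simp: inv_scale_def\<close>)

text \<open>Correctness of the remaining program enters as a hypothesis, so the minimiser
  \<open>x\<close> occurs only in statements from the query on.\<close>

lemma scale_correct:
  assumes I: "inv_power n s" and ask: "\<And>s. inv_scale m s \<Longrightarrow> wp H ask k qs R s"
  shows "wp H scale (m * 3 + k + 3) qs R s"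
proof -
  have s: "s 0 = int n" "s (m + 3) = N" "s (m + 4) = N ^ n" using I by (auto simp: inv_power_def)
  have "inv_scale 0 (s(m + 5 := K, m + 1 := 0))"
    using I by (auto simp: inv_power_def inv_scale_def)
  from wp_Seq_after[OF scale_loop_correct[OF this] ask]
  have run: "wp H (Seq scale_loop ask) (m * 3 + k + 1) qs R (s(m + 5 := K, m + 1 := 0))" by simp
  have K: "N ^ n * N ^ n * (N * N * N) = K" by (simp add: K_def power3_eq_cube)
  show ?thesis
    unfolding scale_def using run s H_ge_1 K_le_H
    by (intro wp_Store_Seq) (simp_all add: av_exp K)
qed

lemma perturb_correct:
  assumes I: "inv_prod m s" and scale: "\<And>s. inv_power n s \<Longrightarrow> wp H scale k qs R s"
  shows "wp H perturb (n * 4 + k + 4) qs R s"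
proof -
  have s: "s 0 = int n" "s (m + 2) = W" using I by (auto simp: inv_prod_def W_eq_prod)
  have "inv_power 0 (s(m + 3 := N, m + 4 := 1, m + 1 := 0))"
    using I by (auto simp: inv_power_def inv_prod_def W_eq_prod)
  from wp_Seq_after[OF power_loop_correct[OF this] scale]
  have run: "wp H (Seq power_loop scale) (n * 4 + k + 1) qs R (s(m + 3 := N, m + 4 := 1, m + 1 := 0))"
    by simp
  have N: "2 * (W * W) + 1 = N" by (simp add: N_def power2_eq_square)
  show ?thesis
    unfolding perturb_def using run s H_ge_1 N_le_H
    by (intro wp_Store_Seq) (simp_all add: av_exp N)
qed

lemma svp_search_correct:
  "wp H svp_search (m * 9 + n * 9 + sz K * 3 + 19) [n]
     (\<lambda>s. output_vec n s \<in> lattice B \<and> vnorm (output_vec n s) = lambda1 B) (input_mem n B)"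
proof -
  obtain x where x: "x \<in> carrier_vec n" and opt: "lambda1 B = vnorm (B *\<^sub>v x)"
    and mu: "\<lfloor>(lambda1 B')\<^sup>2\<rfloor> mod K = (L x)\<^sup>2" "\<bar>\<lfloor>(lambda1 B')\<^sup>2\<rfloor>\<bar> \<le> K ^ 4"
    and L: "0 \<le> L x" "L x < K" and xW: "\<And>k. k < n \<Longrightarrow> \<bar>x $ k\<bar> \<le> W\<^sup>2"
    using decodable_minimiser by blast
  let ?s = "(input_mem n B)(m + 2 := int n)"
  have "inv_prod 0 ?s" by (auto simp: inv_prod_def input_mem_props)
  from wp_Seq_after[OF prod_loop_correct[OF this]
      perturb_correct[OF _ scale_correct[OF _ ask_correct[OF _ mu(2)[folded H_def] mu(1) L xW]]]]
  have "wp H (Seq prod_loop perturb)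
      (m * 3 + 1 + (n * 4 + (m * 3 + (sz K * 3 + n * 5 + m * 3 + 10) + 3) + 4)) [n] (inv_mult x m) ?s"
    by simp
  hence "wp H svp_search (m * 9 + n * 9 + sz K * 3 + 19) [n] (inv_mult x m) (input_mem n B)"
    unfolding svp_search_def
    by (intro wp_Store_Seq) (use n_le_H in \<open>simp_all add: av_exp input_mem_props algebra_simps\<close>)
  thus ?thesis
    by (rule wp_mono) (use x opt B in \<open>auto simp: output_eq[OF x] lattice_def\<close>)
qed

section \<open>Polynomial running time\<close>

lemma entry_le_max:
  assumes "i < n" "j < n"
  shows "\<bar>B $$ (i, j)\<bar> \<le> max_entry B"
proof -
  have "{\<bar>B $$ (i, j)\<bar> |i j. i < n \<and> j < n} = (\<lambda>(i, j). \<bar>B $$ (i, j)\<bar>) ` ({..<n} \<times> {..<n})" by auto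
  hence "finite {\<bar>B $$ (i, j)\<bar> |i j. i < n \<and> j < n}" by simp
  thus ?thesis unfolding max_entry_def using B assms by (intro Max_ge) auto
qed

text \<open>A zero matrix would give a unit vector the value 0 under \<open>Q\<close>. The bound
  keeps the logarithm of the largest entry nonnegative.\<close>

lemma max_entry_ge_1: "1 \<le> max_entry B"
proof (rule ccontr)
  assume "\<not> 1 \<le> max_entry B"
  hence "B $$ (i, j) = 0" if "i < n" "j < n" for i j using entry_le_max[OF that] by linarith
  hence "Q (unit_vec n 0) = 0" by (simp add: Q_def y_def)
  moreover have "1 \<le> Q (unit_vec n 0)" using n_ge_1 by (intro Q_pos) auto
  ultimately show False by simp
qed

text \<open>Up to constants, \<open>W\<close> and \<open>N\<close> have at most
  \<open>e = n\<^sup>2 * D\<close> bits, and \<open>K\<close> and \<open>H\<close> at most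
  \<open>f = n * e\<close>. There are O(f) steps of cost O(f^2) each, and
  \<open>f ^ 3 = n ^ 9 * D ^ 3\<close>.\<close>

lemma running_time_le:
  fixes D :: nat
  defines "D \<equiv> sz (max_entry B) + 1"
  shows "(m * 9 + n * 9 + sz K * 3 + 19) * unit_cost H
    \<le> 220 * 20000000 * 246\<^sup>2 * n ^ 9 * D ^ 3"
proof -
  have D: "1 \<le> D" by (simp add: D_def)
  define e where "e = n\<^sup>2 * D"
  have n2: "1 \<le> n\<^sup>2" using n_ge_1 by simp
  have e: "1 \<le> e" "n \<le> e" "n\<^sup>2 \<le> e"
    using n2 D n_ge_1 mult_le_mono[of 1 "n" 1 D] mult_le_mono[of 1 n n "n * D"]
    by (auto simp: e_def power2_eq_square)
  have "sz (entry_prod B) \<le> m * (2 * D) + 1"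
  proof -
    have "sz (1 + (b u)\<^sup>2) \<le> 2 * D" if "u < m" for u
    proof -
      have "\<bar>b u\<bar> \<le> \<bar>max_entry B\<bar>"
        using entry_le_max[of "u div n" "u mod n"] that n_ge_1
        by (auto simp: b_def m_def less_mult_imp_div_less)
      from sz_mono[OF this] show ?thesis
        using sz_add[of 1 "(b u)\<^sup>2"] sz_mult[of "b u" "b u"] by (simp add: D_def power2_eq_square)
    qed
    hence "sz (\<Prod>u<m. 1 + (b u)\<^sup>2) \<le> m * (2 * D) + 1"
      using sz_prod_le[of "{..<m}" "\<lambda>u. 1 + (b u)\<^sup>2" "2 * D"] by simp
    thus ?thesis
      using B by (simp add: b_def m_def entry_prod_def prod_div_mod[of "\<lambda>i j. 1 + (B $$ (i, j))\<^sup>2"])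
  qed
  moreover have "m * (2 * D) = 2 * e" by (simp add: m_def e_def power2_eq_square)
  ultimately have "sz (entry_prod B) \<le> 3 * e" using e by linarith
  moreover have "sz (int n) \<le> n" using sz_le_nat_abs[of "int n"] by simp
  ultimately have W: "sz W \<le> 4 * e" using sz_mult[of "int n" "entry_prod B"] e by (simp add: W_def)
  have "sz N \<le> 12 * e"
    using sz_add[of "2 * W\<^sup>2" 1] sz_mult[of 2 "W\<^sup>2"] sz_mult[of W W] W e
    by (simp add: N_def power2_eq_square)
  hence "(2 * n + 3) * sz N \<le> (5 * n) * (12 * e)" using n_ge_1 by (intro mult_le_mono) auto
  moreover have "K = N ^ (2 * n + 3)" by (simp only: K_def power_add mult_2)
  hence "sz K \<le> (2 * n + 3) * sz N + 1" using sz_power[of N "2 * n + 3"] by (simp only:)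
  moreover define f where "f = n * e"
  hence "(5 * n) * (12 * e) = 60 * f" by simp
  ultimately have K: "sz K \<le> 60 * f + 1" by linarith
  have f: "1 \<le> f" "e \<le> f" using n_ge_1 e mult_le_mono[of 1 n e e] by (auto simp: f_def)
  \<comment> \<open>Four times \<open>60 * f + 1\<close>, plus 1 from \<open>sz_power\<close>, is
    within this bound because \<open>f\<close> is at least 1. The 220 below is 9 + 9 + 3 * 60 + 3 +
    19.\<close>
  have "sz H \<le> 244 * f + 1" using sz_power[of K 4] K f by (simp add: H_def)
  hence "(sz H + 1)\<^sup>2 \<le> (246 * f)\<^sup>2" using f by (intro power_mono) auto
  moreover have "m * 9 + n * 9 + sz K * 3 + 19 \<le> 220 * f"
    using K e f by (simp add: m_def power2_eq_square)
  ultimately have "(m * 9 + n * 9 + sz K * 3 + 19) * unit_cost H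
      \<le> (220 * f) * (20000000 * (246 * f)\<^sup>2)"
    unfolding unit_cost_def by (intro mult_le_mono) auto
  also have "\<dots> = 220 * 20000000 * 246\<^sup>2 * f ^ 3"
    by (simp add: power2_eq_square power3_eq_cube)
  also have "f ^ 3 = n ^ 9 * D ^ 3"
    by (simp add: f_def e_def power_mult_distrib power2_eq_square eval_nat_numeral mult.assoc)
  finally show ?thesis by (simp add: mult.assoc)
qed

end

theorem mainTheorem6:
  shows "\<exists>(P :: com) (C :: nat) (k :: nat). \<forall>(n :: nat) (B :: int mat).
    n \<ge> 1 \<longrightarrow> B \<in> carrier_mat n n \<longrightarrow> det B \<noteq> 0 \<longrightarrow>
    (\<exists>s' t qs. big P (input_mem n B) s' t qs \<and> qs = [n] \<and>
       real t \<le> real C * (real n + log 2 (real n) + log 2 (real_of_int (max_entry B)) + 1) ^ k \<and>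
       output_vec n s' \<in> lattice B \<and>
       vnorm (output_vec n s') = lambda1 B)"
proof (rule exI[of _ svp_search], rule exI[of _ "220 * 20000000 * 246\<^sup>2"], rule exI[of _ 12], intro allI impI)
  fix n :: nat and B :: "int mat"
  assume "n \<ge> 1" "B \<in> carrier_mat n n" "det B \<noteq> 0"
  then interpret svp_instance n B by unfold_locales
  let ?D = "sz (max_entry B) + 1"
  let ?X = "real n + log 2 (real n) + log 2 (real_of_int (max_entry B)) + 1"
  obtain s' t where run: "big svp_search (input_mem n B) s' t [n]"
    "t \<le> (m * 9 + n * 9 + sz K * 3 + 19) * unit_cost H"
    "output_vec n s' \<in> lattice B" "vnorm (output_vec n s') = lambda1 B"
    using svp_search_correct bounded_input unfolding wp_def by blast
  have ln: "0 \<le> log 2 (real n)" "0 \<le> log 2 (real_of_int (max_entry B))"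
    using n_ge_1 max_entry_ge_1 by auto
  \<comment> \<open>\<open>sz\<close> exceeds the logarithm by at most 1 and \<open>?D\<close> adds
    another 1; the constant summand of \<open>?X\<close> covers one of them and
    \<open>real n\<close> the other.\<close>
  have D: "real ?D \<le> ?X"
  proof -
    have "1 \<le> real n" using n_ge_1 by simp
    thus ?thesis using sz_le_log[OF max_entry_ge_1] ln by linarith
  qed
  have n: "real n \<le> ?X" using ln by simp
  have "t \<le> 220 * 20000000 * 246\<^sup>2 * n ^ 9 * ?D ^ 3"
    using run(2) running_time_le by (rule le_trans)
  hence "real t \<le> real (220 * 20000000 * 246\<^sup>2 * n ^ 9 * ?D ^ 3)" by (rule of_nat_mono)
  also have "\<dots> = real (220 * 20000000 * 246\<^sup>2) * (real n ^ 9 * real ?D ^ 3)"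
    by (simp only: of_nat_mult of_nat_power mult.assoc)
  \<comment> \<open>Dimension and bit length are both replaced by \<open>?X\<close>, so the
    exponents 9 and 3 add up to 12.\<close>
  also have "\<dots> \<le> real (220 * 20000000 * 246\<^sup>2) * (?X ^ 9 * ?X ^ 3)"
    using D n by (intro mult_left_mono mult_mono power_mono) auto
  also have "?X ^ 9 * ?X ^ 3 = ?X ^ 12" by (simp flip: power_add)
  finally show "\<exists>s' t qs. big svp_search (input_mem n B) s' t qs \<and> qs = [n] \<and>
       real t \<le> real (220 * 20000000 * 246\<^sup>2) * ?X ^ 12 \<and>
       output_vec n s' \<in> lattice B \<and> vnorm (output_vec n s') = lambda1 B"
    using run by blast
qed

end
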